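(* Assume $f_j'(u)+1\ne0$ and $f_j''(u)\neq0$ for all $u\in\mathbb R$ and all $1\le j\le k$. For an integer $\ell\ge1$ define the function on $\mathcal M_F$ $$\beta_\ell=\sum_{j=1}^k\frac{f_j^{(\ell+1)}(u_j)\,\bigl(1+f_j'(u_j)\bigr)^{\ell-1}}{\bigl(f_j''(u_j)\bigr)^{\ell}}.$$ (1) $\beta_\ell$ is an $\ell$-model invariant: if $F'$ is another $k$-tuple of functions satisfying the same hypotheses (with the same signs $\varepsilon_i$), $P\in\mathcal M_F$, $Q\in\mathcal M_{F'}$, and $\Phi:T_P\mathcal M_F\to T_Q\mathcal M_{F'}$ is a linear isometry with $\Phi^*(\nabla^iR)_Q=(\nabla^iR)_P$ for $0\le i\le\ell$, then $\beta_\ell^{F}(P)=\beta_\ell^{F'}(Q)$. (2) If $\mathcal M_F$ is $\ell$-curvature homogeneous, then $\beta_p$ is constant on $\mathcal M_F$ for every $p=1,\dots,\ell$. (3) If $\mathcal M_F$ is locally homogeneous, then $\beta_\ell$ is constant for every $\ell\ge1$.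
   Context: Fix an integer $k\ge 1$ and signs $\varepsilon_1,\dots,\varepsilon_k\in\{\pm1\}$. Let $f_1,\dots,f_k:\mathbb R\to\mathbb R$ be smooth, $F=(f_1,\dots,f_k)$. On $\mathbb R^{3k+2}$ with coordinates $(u_0,\dots,u_k,v_0,\dots,v_k,s_1,\dots,s_k)$ let $g_F$ be the symmetric metric whose only nonzero components on coordinate vector fields are (up to symmetry), for $1\le i\le k$ and $0\le i',j\le k$: $g_F(\partial_{u_0},\partial_{u_i})=2f_i(u_i)s_i$, $g_F(\partial_{u_i},\partial_{u_i})=-2u_0s_i$, $g_F(\partial_{u_{i'}},\partial_{v_j})=\delta_{i'j}$, $g_F(\partial_{s_i},\partial_{s_i})=\varepsilon_i$; $\mathcal M_F=(\mathbb R^{3k+2},g_F)$. $\nabla$ is the Levi-Civita connection, $R(X,Y,Z,W)=g_F(\nabla_X\nabla_YZ-\nabla_Y\nabla_XZ-\nabla_{[X,Y]}Z,W)$, $\nabla^0R=R$ and $\nabla^\ell R(X_1,\dots,X_4;Y_1,\dots,Y_\ell)=(\nabla_{Y_\ell}\nabla^{\ell-1}R)(X_1,\dots,X_4;Y_1,\dots,Y_{\ell-1})$. A pseudo-Riemannian manifold $(M,g)$ is $\ell$-curvature homogeneous if for all $P,Q\in M$ there is a linear isometry $\Phi:T_PM\to T_QM$ with $\Phi^*(\nabla^iR)_Q=(\nabla^iR)_P$ for $i=0,\dots,\ell$. It is locally homogeneous if for all $P,Q$ there is an isometry between neighborhoods of $P$ and $Q$ sending $P$ to $Q$. *)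

theory Defs
  imports "HOL-Analysis.Analysis"
begin

text \<open>Points of R^N are functions nat => real vanishing at indices >= N.
  Tangent vectors are represented the same way (components in the
  coordinate frame).  Vector fields map points to component vectors.\<close>

type_synonym pt = "nat \<Rightarrow> real"
type_synonym vfield = "pt \<Rightarrow> pt"
type_synonym metric = "pt \<Rightarrow> nat \<Rightarrow> nat \<Rightarrow> real"
type_synonym tensor = "vfield list \<Rightarrow> pt \<Rightarrow> real"

definition pts :: "nat \<Rightarrow> pt set" where
  "pts N = {x. \<forall>i\<ge>N. x i = 0}"

definition pd :: "(pt \<Rightarrow> real) \<Rightarrow> nat \<Rightarrow> pt \<Rightarrow> real" where
  "pd h i x = deriv (\<lambda>t. h (x(i := x i + t))) 0"

fun pd_iter :: "nat list \<Rightarrow> (pt \<Rightarrow> real) \<Rightarrow> pt \<Rightarrow> real" where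
  "pd_iter [] h = h"
| "pd_iter (i # is) h = pd (pd_iter is h) i"

definition smooth_on :: "nat \<Rightarrow> pt set \<Rightarrow> (pt \<Rightarrow> real) \<Rightarrow> bool" where
  "smooth_on N U h \<longleftrightarrow>
     (\<forall>is. set is \<subseteq> {..<N} \<longrightarrow>
        continuous_on U (pd_iter is h) \<and>
        (\<forall>x\<in>U. \<forall>i<N. (\<lambda>t. pd_iter is h (x(i := x i + t))) differentiable (at 0)))"

definition gval :: "nat \<Rightarrow> metric \<Rightarrow> pt \<Rightarrow> pt \<Rightarrow> pt \<Rightarrow> real" where
  "gval N g x v w = (\<Sum>a<N. \<Sum>b<N. g x a b * v a * w b)"

definition ginv :: "nat \<Rightarrow> metric \<Rightarrow> pt \<Rightarrow> nat \<Rightarrow> nat \<Rightarrow> real" where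
  "ginv N g x = (THE h. (\<forall>a c. (N \<le> a \<or> N \<le> c) \<longrightarrow> h a c = 0) \<and>
       (\<forall>a<N. \<forall>c<N. (\<Sum>b<N. g x a b * h b c) = (if a = c then 1 else 0)))"

definition chr1 :: "metric \<Rightarrow> nat \<Rightarrow> nat \<Rightarrow> nat \<Rightarrow> pt \<Rightarrow> real" where
  "chr1 g a b c x = (pd (\<lambda>y. g y b c) a x + pd (\<lambda>y. g y a c) b x - pd (\<lambda>y. g y a b) c x) / 2"

definition chr :: "nat \<Rightarrow> metric \<Rightarrow> nat \<Rightarrow> nat \<Rightarrow> nat \<Rightarrow> pt \<Rightarrow> real" where
  "chr N g e a b x = (\<Sum>c<N. ginv N g x e c * chr1 g a b c x)"

definition conn :: "nat \<Rightarrow> metric \<Rightarrow> vfield \<Rightarrow> vfield \<Rightarrow> vfield" where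
  "conn N g X Y = (\<lambda>x e. if e < N then
      (\<Sum>a<N. X x a * (pd (\<lambda>y. Y y e) a x + (\<Sum>b<N. chr N g e a b x * Y x b)))
    else 0)"

definition ddir :: "nat \<Rightarrow> vfield \<Rightarrow> (pt \<Rightarrow> real) \<Rightarrow> pt \<Rightarrow> real" where
  "ddir N X h x = (\<Sum>a<N. X x a * pd h a x)"

definition lie :: "nat \<Rightarrow> vfield \<Rightarrow> vfield \<Rightarrow> vfield" where
  "lie N X Y = (\<lambda>x e. if e < N then ddir N X (\<lambda>y. Y y e) x - ddir N Y (\<lambda>y. X y e) x else 0)"

definition curv :: "nat \<Rightarrow> metric \<Rightarrow> vfield \<Rightarrow> vfield \<Rightarrow> vfield \<Rightarrow> vfield \<Rightarrow> pt \<Rightarrow> real" where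
  "curv N g X Y Z W x = gval N g x
     (\<lambda>e. conn N g X (conn N g Y Z) x e - conn N g Y (conn N g X Z) x e
          - conn N g (lie N X Y) Z x e) (W x)"

definition curvT :: "nat \<Rightarrow> metric \<Rightarrow> tensor" where
  "curvT N g Xs = curv N g (Xs ! 0) (Xs ! 1) (Xs ! 2) (Xs ! 3)"

definition covD :: "nat \<Rightarrow> metric \<Rightarrow> tensor \<Rightarrow> vfield \<Rightarrow> tensor" where
  "covD N g T Y Xs x = ddir N Y (T Xs) x
      - (\<Sum>j<length Xs. T (Xs[j := conn N g Y (Xs ! j)]) x)"

fun nablaR :: "nat \<Rightarrow> metric \<Rightarrow> nat \<Rightarrow> tensor" where
  "nablaR N g 0 = curvT N g"
| "nablaR N g (Suc l) = (\<lambda>Xs. covD N g (nablaR N g l) (last Xs) (butlast Xs))"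

definition tensor_at :: "tensor \<Rightarrow> pt \<Rightarrow> pt list \<Rightarrow> real" where
  "tensor_at T x vs = T (map (\<lambda>v. \<lambda>_. v) vs) x"

definition lin_map :: "nat \<Rightarrow> (nat \<Rightarrow> nat \<Rightarrow> real) \<Rightarrow> pt \<Rightarrow> pt" where
  "lin_map N A v = (\<lambda>b. if b < N then (\<Sum>a<N. A b a * v a) else 0)"

definition model_iso :: "nat \<Rightarrow> metric \<Rightarrow> pt \<Rightarrow> metric \<Rightarrow> pt \<Rightarrow> (nat \<Rightarrow> nat \<Rightarrow> real) \<Rightarrow> nat \<Rightarrow> bool" where
  "model_iso N g P g' Q A l \<longleftrightarrow>
     (\<forall>v\<in>pts N. \<forall>w\<in>pts N. gval N g' Q (lin_map N A v) (lin_map N A w) = gval N g P v w) \<and>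
     (\<forall>i\<le>l. \<forall>vs. length vs = 4 + i \<and> set vs \<subseteq> pts N \<longrightarrow>
        tensor_at (nablaR N g' i) Q (map (lin_map N A) vs) = tensor_at (nablaR N g i) P vs)"

definition curv_homog :: "nat \<Rightarrow> metric \<Rightarrow> nat \<Rightarrow> bool" where
  "curv_homog N g l \<longleftrightarrow> (\<forall>P\<in>pts N. \<forall>Q\<in>pts N. \<exists>A. model_iso N g P g Q A l)"

definition dmap :: "nat \<Rightarrow> (pt \<Rightarrow> pt) \<Rightarrow> pt \<Rightarrow> pt \<Rightarrow> pt" where
  "dmap N \<phi> x v = (\<lambda>b. if b < N then (\<Sum>a<N. pd (\<lambda>y. \<phi> y b) a x * v a) else 0)"

definition loc_isom :: "nat \<Rightarrow> metric \<Rightarrow> pt set \<Rightarrow> pt set \<Rightarrow> (pt \<Rightarrow> pt) \<Rightarrow> bool" where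
  "loc_isom N g U V \<phi> \<longleftrightarrow>
     openin (top_of_set (pts N)) U \<and> openin (top_of_set (pts N)) V \<and>
     bij_betw \<phi> U V \<and>
     (\<forall>b<N. smooth_on N U (\<lambda>x. \<phi> x b)) \<and>
     (\<forall>b<N. smooth_on N V (\<lambda>y. inv_into U \<phi> y b)) \<and>
     (\<forall>x\<in>U. \<forall>v\<in>pts N. \<forall>w\<in>pts N.
        gval N g (\<phi> x) (dmap N \<phi> x v) (dmap N \<phi> x w) = gval N g x v w)"

definition loc_homog :: "nat \<Rightarrow> metric \<Rightarrow> bool" where
  "loc_homog N g \<longleftrightarrow> (\<forall>P\<in>pts N. \<forall>Q\<in>pts N. \<exists>U V \<phi>. P \<in> U \<and> \<phi> P = Q \<and> loc_isom N g U V \<phi>)"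

text \<open>Coordinates: index i (0..k) is u_i, index k+1+j (0..k) is v_j,
  index 2k+1+i (1..k) is s_i.  Dimension 3k+2.  F j is f_j for 1 <= j <= k.\<close>

definition gF :: "nat \<Rightarrow> (nat \<Rightarrow> real) \<Rightarrow> (nat \<Rightarrow> real \<Rightarrow> real) \<Rightarrow> metric" where
  "gF k eps F x a b =
     (if a = 0 \<and> 1 \<le> b \<and> b \<le> k then 2 * F b (x b) * x (2*k+1+b)
      else if b = 0 \<and> 1 \<le> a \<and> a \<le> k then 2 * F a (x a) * x (2*k+1+a)
      else if 1 \<le> a \<and> a \<le> k \<and> a = b then - 2 * x 0 * x (2*k+1+a)
      else if a \<le> k \<and> b = k+1+a then 1
      else if b \<le> k \<and> a = k+1+b then 1
      else if 2*k+2 \<le> a \<and> a \<le> 3*k+1 \<and> a = b then eps (a - (2*k+1))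
      else 0)"

definition admissible :: "nat \<Rightarrow> (nat \<Rightarrow> real \<Rightarrow> real) \<Rightarrow> bool" where
  "admissible k F \<longleftrightarrow> (\<forall>j\<in>{1..k}.
     (\<forall>n u. ((deriv ^^ n) (F j)) differentiable (at u)) \<and>
     (\<forall>u. deriv (F j) u + 1 \<noteq> 0 \<and> (deriv ^^ 2) (F j) u \<noteq> 0))"

definition beta :: "nat \<Rightarrow> (nat \<Rightarrow> real \<Rightarrow> real) \<Rightarrow> nat \<Rightarrow> pt \<Rightarrow> real" where
  "beta l F k x = (\<Sum>j=1..k. (deriv ^^ (l+1)) (F j) (x j) * (1 + deriv (F j) (x j)) ^ (l - 1)
                            / ((deriv ^^ 2) (F j) (x j)) ^ l)"

end

theory Submission
  imports Defs "Jordan_Normal_Form.Determinant"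
begin

text \<open>
  The Levi-Civita connection, the curvature and its covariant derivatives commute with the transport
  of vector fields along an isometry: the Koszul formula involves only the metric and Lie brackets.
  As \<open>\<nabla>\<^sup>lR\<close> is a tensor, the differential of a local isometry is an isomorphism of models of every
  order, so local homogeneity implies curvature homogeneity of every order.

  For the metric \<open>g\<^sub>F\<close> the forms \<open>du\<^sub>0, \<dots>, du\<^sub>k\<close> are parallel and \<open>\<nabla>\<^sub>y(du\<^sub>i \<and> ds\<^sub>i)\<close> is a
  multiple of \<open>du\<^sub>i \<and> du\<^sub>0\<close>.  Hence \<open>\<nabla>\<^sup>lR\<close> has a closed form in which, apart from terms that do not see the
  \<open>s\<close>-directions, the only components are \<open>p\<^sub>i\<^sub>,\<^sub>l = \<nabla>\<^sup>lR(u\<^sub>0,u\<^sub>i,u\<^sub>i,s\<^sub>i;u\<^sub>i,\<dots>,u\<^sub>i)\<close> with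
  \<open>p\<^sub>i\<^sub>,\<^sub>0 = 1 + f\<^sub>i'\<close> and \<open>p\<^sub>i\<^sub>,\<^sub>l\<close> the derivative of order \<open>l + 1\<close> of \<open>f\<^sub>i\<close>.

  The null space of \<open>R\<close> is \<open>span(\<partial>\<^sub>v)\<close>, and its orthogonal complement is
  \<open>W = span(\<partial>\<^sub>v, \<partial>\<^sub>s)\<close>.  A vector \<open>y\<close> with \<open>\<nabla>R(\<cdot>,\<cdot>,\<cdot>,w;y) = R(\<cdot>,\<cdot>,\<cdot>,w)\<close> for all \<open>w\<close> in \<open>W\<close>
  has \<open>u\<^sub>i\<close>-components \<open>p\<^sub>i\<^sub>,\<^sub>0 / p\<^sub>i\<^sub>,\<^sub>1\<close>, and \<open>\<nabla>\<^sup>lR(\<cdot>,\<cdot>,\<cdot>,w;y,\<dots>,y) = R(\<cdot>,\<cdot>,\<cdot>,Ow)\<close> defines an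
  endomorphism \<open>O\<close> of \<open>W / span(\<partial>\<^sub>v)\<close> which is diagonal in the basis \<open>\<partial>\<^sub>s\<close> and whose trace is
  \<open>\<beta>\<^sub>l\<close>.  An isomorphism of models conjugates one such endomorphism into the other.
\<close>

section \<open>Partial derivatives on open sets of coordinate space\<close>

lemma pts_update: "x \<in> pts N \<Longrightarrow> a < N \<Longrightarrow> x(a := r) \<in> pts N"
  by (auto simp: pts_def)

lemma pd_eqI: "((\<lambda>t. h (x(a := x a + t))) has_real_derivative d) (at 0) \<Longrightarrow> pd h a x = d"
  unfolding pd_def by (rule DERIV_imp_deriv)

lemma DERIV_coordinate_line:
  "((\<lambda>t. (x(a := x a + t)) b) has_real_derivative (if b = a then 1 else 0)) (at (0::real))"
  for x :: pt
  by (auto intro!: derivative_eq_intros)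

definition cube :: "nat \<Rightarrow> pt \<Rightarrow> real \<Rightarrow> pt set" where
  "cube N x e = {y \<in> pts N. \<forall>a<N. \<bar>y a - x a\<bar> < e}"

locale coordinate_domain =
  fixes N :: nat and U :: "pt set"
  assumes openin_U: "openin (top_of_set (pts N)) U"
begin

lemma U_subset_pts: "x \<in> U \<Longrightarrow> x \<in> pts N"
  using openin_U openin_imp_subset by blast

lemma contains_cube:
  assumes "x \<in> U"
  obtains e where "e > 0" "cube N x e \<subseteq> U"
proof (rule ccontr)
  assume "\<not> thesis"
  then have "\<exists>y. y \<in> cube N x (inverse (real (Suc n))) \<and> y \<notin> U" for n
    using that[of "inverse (real (Suc n))"] by auto
  then obtain y where y: "\<And>n. y n \<in> cube N x (inverse (real (Suc n)))" "\<And>n. y n \<notin> U"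
    by metis
  have "(\<lambda>n. y n a) \<longlonglongrightarrow> x a" for a
  proof (cases "a < N")
    case True
    have "(\<lambda>n. y n a - x a) \<longlonglongrightarrow> 0"
      by (rule tendsto_rabs_zero_cancel,
          rule tendsto_sandwich[OF _ _ tendsto_const LIMSEQ_inverse_real_of_nat])
        (use y(1) True in \<open>simp_all add: cube_def less_imp_le\<close>)
    then show ?thesis by (rule LIM_zero_cancel)
  next
    case False
    then show ?thesis using y(1) U_subset_pts[OF assms] by (simp add: cube_def pts_def)
  qed
  then have "y \<longlonglongrightarrow> x"
    by (simp flip: limitin_canonical_iff)
      (simp add: limitin_componentwise flip: euclidean_product_topology)
  moreover obtain S where S: "open S" "U = pts N \<inter> S"
    using openin_U by (auto simp: openin_open)
  ultimately have "\<forall>\<^sub>F n in sequentially. y n \<in> S"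
    using assms by (intro topological_tendstoD) auto
  then show False using S y by (auto simp: cube_def dest: eventually_happens)
qed

lemma continuous_on_cube:
  fixes h :: "pt \<Rightarrow> real"
  assumes "continuous_on U h" "x \<in> U" "0 < e"
  obtains d where "d > 0" "cube N x d \<subseteq> U" "\<And>y. y \<in> cube N x d \<Longrightarrow> \<bar>h y - h x\<bar> < e"
proof -
  have "openin (top_of_set U) (U \<inter> h -` ball (h x) e)"
    using assms(1) by (intro continuous_openin_preimage_gen) auto
  then interpret near: coordinate_domain N "U \<inter> h -` ball (h x) e"
    using openin_U by unfold_locales (rule openin_trans)
  obtain d where d: "d > 0" "cube N x d \<subseteq> U \<inter> h -` ball (h x) e"
    using near.contains_cube[of x] assms by auto
  then show ?thesis
    by (intro that[of d]) (auto simp: dist_real_def abs_minus_commute)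
qed

lemma eventually_coordinate_line:
  assumes "x \<in> U" "a < N"
  shows "\<forall>\<^sub>F t in nhds 0. x(a := x a + t) \<in> U"
proof -
  obtain e where e: "e > 0" "cube N x e \<subseteq> U"
    using contains_cube[OF assms(1)] .
  have "x(a := x a + t) \<in> cube N x e" if "dist t 0 < e" for t
    using that e(1) assms by (auto simp: cube_def pts_update U_subset_pts)
  then show ?thesis
    using e by (auto simp: eventually_nhds_metric)
qed

lemma pd_cong:
  assumes "x \<in> U" "a < N" "\<And>y. y \<in> U \<Longrightarrow> f y = h y"
  shows "pd f a x = pd h a x"
  unfolding pd_def using eventually_coordinate_line[OF assms(1,2)]
  by (intro deriv_cong_ev refl) (auto elim: eventually_mono simp: assms(3))

end

section \<open>The algebra of smooth functions\<close>

definition smooth_fn :: "(real \<Rightarrow> real) \<Rightarrow> bool" where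
  "smooth_fn h \<longleftrightarrow> (\<forall>n u. ((deriv ^^ n) h) differentiable (at u))"

lemma smooth_fn_DERIV:
  assumes "smooth_fn h"
  shows "(h has_real_derivative deriv h u) (at u)"
  using assms[unfolded smooth_fn_def, rule_format, of 0 u]
  by (simp add: DERIV_deriv_iff_real_differentiable)

lemma smooth_fn_deriv: "smooth_fn h \<Longrightarrow> smooth_fn (deriv h)"
  unfolding smooth_fn_def by (metis comp_apply funpow_Suc_right)

context coordinate_domain
begin

primrec smooth_upto :: "nat \<Rightarrow> (pt \<Rightarrow> real) \<Rightarrow> bool" where
  "smooth_upto 0 h \<longleftrightarrow> True"
| "smooth_upto (Suc n) h \<longleftrightarrow> continuous_on U h
     \<and> (\<forall>x\<in>U. \<forall>a<N. (\<lambda>t. h (x(a := x a + t))) differentiable (at 0))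
     \<and> (\<forall>a<N. smooth_upto n (pd h a))"

lemma pd_iter_append: "pd_iter (as @ [a]) h = pd_iter as (pd h a)"
  by (induction as) auto

lemma smooth_on_pd: "smooth_on N U h \<Longrightarrow> a < N \<Longrightarrow> smooth_on N U (pd h a)"
  unfolding smooth_on_def pd_iter_append[symmetric] by auto

lemma smooth_on_continuous: "smooth_on N U h \<Longrightarrow> continuous_on U h"
  and smooth_on_differentiable: "smooth_on N U h \<Longrightarrow> x \<in> U \<Longrightarrow> a < N \<Longrightarrow>
    (\<lambda>t. h (x(a := x a + t))) differentiable (at 0)"
  unfolding smooth_on_def by (metis empty_iff list.set(1) pd_iter.simps(1) subsetI)+

lemma smooth_on_iff_upto: "smooth_on N U h \<longleftrightarrow> (\<forall>n. smooth_upto n h)"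
proof
  assume "smooth_on N U h"
  then have "smooth_upto n h" for n
    by (induction n arbitrary: h)
        (simp_all add: smooth_on_continuous smooth_on_differentiable smooth_on_pd)
  then show "\<forall>n. smooth_upto n h" ..
next
  have pd_iter: "smooth_upto (Suc 0) (pd_iter as h)"
    if "set as \<subseteq> {..<N}" "smooth_upto (Suc (length as)) h" for as h
    using that
  proof (induction as arbitrary: h rule: rev_induct)
    case (snoc a as)
    then show ?case by (simp add: pd_iter_append)
  qed simp
  assume "\<forall>n. smooth_upto n h"
  then show "smooth_on N U h"
    unfolding smooth_on_def using pd_iter by (metis smooth_upto.simps(2))
qed

lemma smooth_upto_SucD: "smooth_upto (Suc n) h \<Longrightarrow> smooth_upto n h"
  by (induction n arbitrary: h) auto

lemma smooth_upto_DERIV: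
  "smooth_upto (Suc n) h \<Longrightarrow> x \<in> U \<Longrightarrow> a < N \<Longrightarrow>
    ((\<lambda>t. h (x(a := x a + t))) has_real_derivative pd h a x) (at 0)"
  unfolding pd_def by (simp add: DERIV_deriv_iff_real_differentiable)

lemma smooth_on_DERIV:
  "smooth_on N U h \<Longrightarrow> x \<in> U \<Longrightarrow> a < N \<Longrightarrow>
    ((\<lambda>t. h (x(a := x a + t))) has_real_derivative pd h a x) (at 0)"
  unfolding smooth_on_iff_upto using smooth_upto_DERIV by blast

lemma smooth_upto_cong:
  "smooth_upto n f \<Longrightarrow> (\<And>x. x \<in> U \<Longrightarrow> f x = h x) \<Longrightarrow> smooth_upto n h"
proof (induction n arbitrary: f h)
  case (Suc n)
  have "((\<lambda>t. h (x(a := x a + t))) has_real_derivative pd f a x) (at 0)" if "x \<in> U" "a < N" for x a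
  proof -
    have "\<forall>\<^sub>F t in nhds 0. f (x(a := x a + t)) = h (x(a := x a + t))"
      using eventually_coordinate_line[OF that] by eventually_elim (rule Suc.prems(2))
    from DERIV_cong_ev[OF refl this refl] smooth_upto_DERIV[OF Suc.prems(1) that] show ?thesis
      by blast
  qed
  moreover have "smooth_upto n (pd h a)" if "a < N" for a
  proof (rule Suc.IH)
    show "smooth_upto n (pd f a)" using Suc.prems(1) that by simp
    show "pd f a x = pd h a x" if "x \<in> U" for x
      using that \<open>a < N\<close> Suc.prems(2) by (rule pd_cong)
  qed
  moreover have "continuous_on U h"
    using Suc.prems continuous_on_cong[of U U f h] by auto
  ultimately show ?case by (auto simp: real_differentiable_def)
qed simp

lemma smooth_upto_SucI:
  assumes "continuous_on U h"
    and "\<And>x a. x \<in> U \<Longrightarrow> a < N \<Longrightarrow> ((\<lambda>t. h (x(a := x a + t))) has_real_derivative h' a x) (at 0)"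
    and "\<And>a. a < N \<Longrightarrow> smooth_upto n (h' a)"
  shows "smooth_upto (Suc n) h"
proof -
  have "smooth_upto n (pd h a)" if "a < N" for a
    by (rule smooth_upto_cong[OF assms(3)[OF that]]) (simp add: pd_eqI[OF assms(2)] that)
  then show ?thesis using assms(1,2) by (auto simp: real_differentiable_def)
qed

lemma smooth_upto_const: "smooth_upto n (\<lambda>x. c)"
proof (induction n arbitrary: c)
  case (Suc n)
  show ?case by (rule smooth_upto_SucI[where h' = "\<lambda>a x. 0"]) (simp_all add: Suc)
qed simp

lemma smooth_upto_add: "smooth_upto n f \<Longrightarrow> smooth_upto n h \<Longrightarrow> smooth_upto n (\<lambda>x. f x + h x)"
proof (induction n arbitrary: f h)
  case (Suc n)
  show ?case
    by (rule smooth_upto_SucI[where h' = "\<lambda>a x. pd f a x + pd h a x"])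
      (use Suc in \<open>auto intro!: continuous_on_add DERIV_add smooth_upto_DERIV[of n]
          simp del: fun_upd_apply\<close>)
qed simp

lemma smooth_upto_mult: "smooth_upto n f \<Longrightarrow> smooth_upto n h \<Longrightarrow> smooth_upto n (\<lambda>x. f x * h x)"
proof (induction n arbitrary: f h)
  case (Suc n)
  note lower = Suc.prems[THEN smooth_upto_SucD]
  show ?case
  proof (rule smooth_upto_SucI[where h' = "\<lambda>a x. pd f a x * h x + pd h a x * f x"])
    show "((\<lambda>t. f (x(a := x a + t)) * h (x(a := x a + t))) has_real_derivative
        pd f a x * h x + pd h a x * f x) (at 0)" if "x \<in> U" "a < N" for x a
      using that by (intro DERIV_cong[OF DERIV_mult[OF Suc.prems[THEN smooth_upto_DERIV]]]) simp_all
    show "smooth_upto n (\<lambda>x. pd f a x * h x + pd h a x * f x)" if "a < N" for a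
      using that Suc.prems lower by (intro smooth_upto_add Suc.IH) auto
  qed (use Suc.prems in \<open>auto intro: continuous_on_mult\<close>)
qed simp

lemma smooth_upto_inverse:
  "smooth_upto n h \<Longrightarrow> (\<And>x. x \<in> U \<Longrightarrow> h x \<noteq> 0) \<Longrightarrow> smooth_upto n (\<lambda>x. inverse (h x))"
proof (induction n)
  case (Suc n)
  have inv: "smooth_upto n (\<lambda>x. inverse (h x))"
    using Suc smooth_upto_SucD by blast
  show ?case
  proof (rule smooth_upto_SucI[where
        h' = "\<lambda>a x. (-1) * (pd h a x * (inverse (h x) * inverse (h x)))"])
    show "((\<lambda>t. inverse (h (x(a := x a + t)))) has_real_derivative
        (-1) * (pd h a x * (inverse (h x) * inverse (h x)))) (at 0)" if "x \<in> U" "a < N" for x a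
      using that Suc.prems(2)
      by (intro DERIV_cong[OF DERIV_inverse_fun[OF smooth_upto_DERIV[OF Suc.prems(1)]]])
        (simp_all add: power2_eq_square)
    show "smooth_upto n (\<lambda>x. (-1) * (pd h a x * (inverse (h x) * inverse (h x))))" if "a < N" for a
      using that Suc.prems(1) by (intro smooth_upto_mult smooth_upto_const inv) simp
  qed (use Suc.prems in \<open>auto intro: continuous_on_inverse\<close>)
qed simp

lemma smooth_upto_smooth_fn:
  "smooth_fn q \<Longrightarrow> smooth_upto n h \<Longrightarrow> smooth_upto n (\<lambda>x. q (h x))"
proof (induction n arbitrary: q)
  case (Suc n)
  have q: "continuous_on UNIV q"
    using smooth_fn_DERIV[OF Suc.prems(1)]
    by (intro continuous_at_imp_continuous_on ballI DERIV_isCont)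
  show ?case
  proof (rule smooth_upto_SucI[where h' = "\<lambda>a x. deriv q (h x) * pd h a x"])
    show "continuous_on U (\<lambda>x. q (h x))"
      using Suc.prems(2) by (intro continuous_on_compose2[OF q]) auto
    show "((\<lambda>t. q (h (x(a := x a + t)))) has_real_derivative deriv q (h x) * pd h a x) (at 0)"
      if "x \<in> U" "a < N" for x a
      using DERIV_chain2[OF smooth_fn_DERIV[OF Suc.prems(1)]
          smooth_upto_DERIV[OF Suc.prems(2) that]]
      by (rule DERIV_cong) simp
    show "smooth_upto n (\<lambda>x. deriv q (h x) * pd h a x)" if "a < N" for a
    proof (rule smooth_upto_mult)
      show "smooth_upto n (\<lambda>x. deriv q (h x))"
        by (rule Suc.IH[OF smooth_fn_deriv[OF Suc.prems(1)] smooth_upto_SucD[OF Suc.prems(2)]])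
      show "smooth_upto n (pd h a)"
        using Suc.prems(2) that by simp
    qed
  qed
qed simp

lemma smooth_upto_sum: "(\<And>i. i \<in> S \<Longrightarrow> smooth_upto n (h i)) \<Longrightarrow> smooth_upto n (\<lambda>x. \<Sum>i\<in>S. h i x)"
  by (induction S rule: infinite_finite_induct) (auto intro: smooth_upto_const smooth_upto_add)

lemma smooth_on_const: "smooth_on N U (\<lambda>x. c)"
  and smooth_on_add: "smooth_on N U f \<Longrightarrow> smooth_on N U h \<Longrightarrow> smooth_on N U (\<lambda>x. f x + h x)"
  and smooth_on_mult: "smooth_on N U f \<Longrightarrow> smooth_on N U h \<Longrightarrow> smooth_on N U (\<lambda>x. f x * h x)"
  and smooth_on_sum: "(\<And>i. i \<in> S \<Longrightarrow> smooth_on N U (q i)) \<Longrightarrow> smooth_on N U (\<lambda>x. \<Sum>i\<in>S. q i x)"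
  and smooth_on_inverse:
    "smooth_on N U h \<Longrightarrow> (\<And>x. x \<in> U \<Longrightarrow> h x \<noteq> 0) \<Longrightarrow> smooth_on N U (\<lambda>x. inverse (h x))"
  and smooth_on_smooth_fn: "smooth_fn p \<Longrightarrow> smooth_on N U h \<Longrightarrow> smooth_on N U (\<lambda>x. p (h x))"
  and smooth_on_cong: "smooth_on N U f \<Longrightarrow> (\<And>x. x \<in> U \<Longrightarrow> f x = h x) \<Longrightarrow> smooth_on N U h"
  unfolding smooth_on_iff_upto
  by (blast intro: smooth_upto_const, blast intro: smooth_upto_add, blast intro: smooth_upto_mult,
      blast intro: smooth_upto_sum, blast intro: smooth_upto_inverse,
      blast intro: smooth_upto_smooth_fn, blast intro: smooth_upto_cong)

lemma smooth_on_uminus: "smooth_on N U h \<Longrightarrow> smooth_on N U (\<lambda>x. - h x)"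
  using smooth_on_mult[OF smooth_on_const[of "-1"], of h] by simp

lemma smooth_on_diff: "smooth_on N U f \<Longrightarrow> smooth_on N U h \<Longrightarrow> smooth_on N U (\<lambda>x. f x - h x)"
  using smooth_on_add[OF _ smooth_on_uminus, of f h] by simp

lemma smooth_on_prod: "(\<And>i. i \<in> S \<Longrightarrow> smooth_on N U (h i)) \<Longrightarrow> smooth_on N U (\<lambda>x. \<Prod>i\<in>S. h i x)"
  by (induction S rule: infinite_finite_induct) (auto intro: smooth_on_const smooth_on_mult)

lemma pd_const: "pd (\<lambda>x. c) a x = 0"
  by (rule pd_eqI) simp

lemma pd_add:
  assumes "smooth_on N U f" "smooth_on N U h" "x \<in> U" "a < N"
  shows "pd (\<lambda>x. f x + h x) a x = pd f a x + pd h a x"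
  by (rule pd_eqI) (intro DERIV_add smooth_on_DERIV assms)

lemma pd_mult:
  assumes "smooth_on N U f" "smooth_on N U h" "x \<in> U" "a < N"
  shows "pd (\<lambda>x. f x * h x) a x = pd f a x * h x + f x * pd h a x"
  using DERIV_mult[OF assms(1,2)[THEN smooth_on_DERIV, OF assms(3,4)]]
  by (intro pd_eqI) (simp add: mult.commute add.commute)

end

lemma smooth_on_subset: "smooth_on N U h \<Longrightarrow> V \<subseteq> U \<Longrightarrow> smooth_on N V h"
  unfolding smooth_on_def by (meson continuous_on_subset subset_iff)

section \<open>The chain rule and the symmetry of second derivatives\<close>

lemma cube_update: "y \<in> cube N x e \<Longrightarrow> a < N \<Longrightarrow> \<bar>r - x a\<bar> < e \<Longrightarrow> y(a := r) \<in> cube N x e"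
  by (auto simp: cube_def pts_update)

context coordinate_domain
begin

lemma DERIV_coordinate:
  assumes "smooth_on N U h" "a < N" "y(a := s) \<in> U"
  shows "((\<lambda>s. h (y(a := s))) has_real_derivative pd h a (y(a := s))) (at s)"
proof -
  have "((\<lambda>t. h (y(a := t + s))) has_real_derivative pd h a (y(a := s))) (at 0)"
    using smooth_on_DERIV[OF assms(1,3,2)] by (simp add: add.commute)
  then show ?thesis
    using DERIV_shift[of "\<lambda>s. h (y(a := s))" _ 0 s] by simp
qed

lemma pd_mean_value:
  assumes "smooth_on N U h" "a < N" and segment: "\<And>s. s \<in> closed_segment (y a) r \<Longrightarrow> y(a := s) \<in> U"
  obtains s where "s \<in> closed_segment (y a) r"
    "h (y(a := r)) - h y = (r - y a) * pd h a (y(a := s))"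
proof -
  have D: "((\<lambda>s. h (y(a := s))) has_real_derivative pd h a (y(a := s))) (at s)"
    if "s \<in> closed_segment (y a) r" for s
    using assms(1,2) segment[OF that] by (rule DERIV_coordinate)
  consider (equal) "r = y a" | (less) "r < y a" | (greater) "y a < r" by linarith
  then show ?thesis
  proof cases
    case equal
    then show ?thesis using that[of r] by simp
  next
    case less
    then obtain s where "r < s" "s < y a"
      "h (y(a := y a)) - h (y(a := r)) = (y a - r) * pd h a (y(a := s))"
      using MVT2[OF less D] by (auto simp: closed_segment_eq_real_ivl)
    then show ?thesis
      using that[of s] by (simp add: closed_segment_eq_real_ivl algebra_simps)
  next
    case greater
    then obtain s where "y a < s" "s < r"
      "h (y(a := r)) - h (y(a := y a)) = (r - y a) * pd h a (y(a := s))"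
      using MVT2[OF greater D] by (auto simp: closed_segment_eq_real_ivl)
    then show ?thesis
      using that[of s] by (simp add: closed_segment_eq_real_ivl)
  qed
qed

lemma increment_mean_value:
  assumes h: "smooth_on N U h" and ab: "a < N" "a \<noteq> b" and r: "0 < r"
    and strip: "\<And>s. x a \<le> s \<Longrightarrow> s \<le> x a + r \<Longrightarrow> x(a := s, b := x b + r) \<in> U"
      "\<And>s. x a \<le> s \<Longrightarrow> s \<le> x a + r \<Longrightarrow> x(a := s) \<in> U"
  obtains s where "x a < s" "s < x a + r"
    "(h (x(a := x a + r, b := x b + r)) - h (x(a := x a + r))) - (h (x(b := x b + r)) - h x)
      = r * (pd h a (x(a := s, b := x b + r)) - pd h a (x(a := s)))"
proof -
  have D: "((\<lambda>s. h (x(a := s, b := x b + r)) - h (x(a := s))) has_real_derivative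
      pd h a (x(a := s, b := x b + r)) - pd h a (x(a := s))) (at s)"
    if "x a \<le> s" "s \<le> x a + r" for s
  proof (rule DERIV_diff)
    have twist: "x(a := s, b := x b + r) = x(b := x b + r, a := s)" for s
      using ab(2) by (rule fun_upd_twist)
    show "((\<lambda>s. h (x(a := s, b := x b + r))) has_real_derivative
        pd h a (x(a := s, b := x b + r))) (at s)"
      using DERIV_coordinate[OF h ab(1), of "x(b := x b + r)" s] strip(1)[OF that]
      unfolding twist .
    show "((\<lambda>s. h (x(a := s))) has_real_derivative pd h a (x(a := s))) (at s)"
      using h ab(1) strip(2)[OF that] by (rule DERIV_coordinate)
  qed
  have "x a < x a + r" using r by simp
  from MVT2[OF this D] obtain s where "x a < s" "s < x a + r"
    "(h (x(a := x a + r, b := x b + r)) - h (x(a := x a + r)))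
        - (h (x(a := x a, b := x b + r)) - h (x(a := x a)))
      = (x a + r - x a) * (pd h a (x(a := s, b := x b + r)) - pd h a (x(a := s)))"
    by blast
  then show ?thesis by (intro that[of s]) simp_all
qed

lemma second_difference:
  assumes h: "smooth_on N U h" and ab: "a < N" "b < N" "a \<noteq> b"
    and x: "x \<in> pts N" and cube: "cube N x e \<subseteq> U" and r: "0 < r" "r < e"
  obtains y where "y \<in> cube N x e"
    "h (x(a := x a + r, b := x b + r)) - h (x(a := x a + r)) - h (x(b := x b + r)) + h x
      = r * r * pd (pd h a) b y"
proof -
  have "x \<in> cube N x e" using x r by (simp add: cube_def)
  then have shifted: "x(a := s, b := s') \<in> cube N x e" "x(a := s) \<in> cube N x e"
    if "x a \<le> s" "s \<le> x a + r" "x b \<le> s'" "s' \<le> x b + r" for s s'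
    using that ab r by (auto intro!: cube_update)
  have strip: "x(a := s, b := x b + r) \<in> U" "x(a := s) \<in> U" if "x a \<le> s" "s \<le> x a + r" for s
    using shifted[OF that, of "x b + r"] cube r(1) by auto
  obtain s where s: "x a < s" "s < x a + r"
    "(h (x(a := x a + r, b := x b + r)) - h (x(a := x a + r))) - (h (x(b := x b + r)) - h x)
      = r * (pd h a (x(a := s, b := x b + r)) - pd h a (x(a := s)))"
    using increment_mean_value[OF h ab(1,3) r(1) strip] by blast
  have "(x(a := s))(b := s') \<in> U" if "s' \<in> closed_segment ((x(a := s)) b) (x b + r)" for s'
    using that s(1,2) ab(3) r(1) shifted(1)[of s s'] cube by (auto simp: closed_segment_eq_real_ivl)
  from pd_mean_value[OF smooth_on_pd[OF h ab(1)] ab(2) this]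
  obtain s' where s': "s' \<in> closed_segment ((x(a := s)) b) (x b + r)"
    "pd h a (x(a := s, b := x b + r)) - pd h a (x(a := s))
      = (x b + r - (x(a := s)) b) * pd (pd h a) b (x(a := s, b := s'))"
    by blast
  show ?thesis
  proof (rule that)
    show "x(a := s, b := s') \<in> cube N x e"
      using s s' r ab(3) by (intro shifted) (auto simp: closed_segment_eq_real_ivl)
    show "h (x(a := x a + r, b := x b + r)) - h (x(a := x a + r)) - h (x(b := x b + r)) + h x
        = r * r * pd (pd h a) b (x(a := s, b := s'))"
      using s(3) s'(2) ab(3) by simp
  qed
qed

lemma pd_commute:
  assumes h: "smooth_on N U h" and x: "x \<in> U" and ab: "a < N" "b < N"
  shows "pd (pd h a) b x = pd (pd h b) a x"
proof (rule ccontr)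
  let ?A = "pd (pd h a) b" and ?B = "pd (pd h b) a"
  assume ne: "?A x \<noteq> ?B x"
  then have "a \<noteq> b" by blast
  define e where "e = \<bar>?A x - ?B x\<bar> / 2"
  have "e > 0" using ne by (simp add: e_def)
  have continuous: "continuous_on U ?A" "continuous_on U ?B"
    using h ab by (auto intro!: smooth_on_continuous smooth_on_pd)
  obtain d1 where d1: "d1 > 0" "cube N x d1 \<subseteq> U" "\<And>y. y \<in> cube N x d1 \<Longrightarrow> \<bar>?A y - ?A x\<bar> < e"
    using continuous_on_cube[OF continuous(1) x \<open>e > 0\<close>] by blast
  obtain d2 where d2: "d2 > 0" "cube N x d2 \<subseteq> U" "\<And>y. y \<in> cube N x d2 \<Longrightarrow> \<bar>?B y - ?B x\<bar> < e"
    using continuous_on_cube[OF continuous(2) x \<open>e > 0\<close>] by blast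
  define r where "r = min d1 d2 / 2"
  have r: "0 < r" "r < d1" "r < d2" using d1(1) d2(1) by (auto simp: r_def)
  obtain y where y: "y \<in> cube N x d1"
    "h (x(a := x a + r, b := x b + r)) - h (x(a := x a + r)) - h (x(b := x b + r)) + h x
        = r * r * ?A y"
    using second_difference[OF h ab \<open>a \<noteq> b\<close> U_subset_pts[OF x] d1(2) r(1,2)] .
  obtain z where z: "z \<in> cube N x d2"
    "h (x(b := x b + r, a := x a + r)) - h (x(b := x b + r)) - h (x(a := x a + r)) + h x
        = r * r * ?B z"
    using second_difference[OF h ab(2,1) \<open>a \<noteq> b\<close>[symmetric] U_subset_pts[OF x] d2(2) r(1,3)] .
  have "x(a := x a + r, b := x b + r) = x(b := x b + r, a := x a + r)"
    using \<open>a \<noteq> b\<close> by (rule fun_upd_twist)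
  then have "r * r * ?A y = r * r * ?B z"
    using y(2) z(2) by (simp only: flip: y(2) z(2))
  then have "?A y = ?B z" using r(1) by simp
  then show False
    using d1(3)[OF y(1)] d2(3)[OF z(1)] unfolding e_def by (smt (verit) field_sum_of_halves)
qed

lemma difference_quotient_tendsto:
  assumes h: "smooth_on N U h" and x: "x \<in> U" and a: "a < N" and r: "(r \<longlongrightarrow> x a) \<F>"
    and y: "\<forall>\<^sub>F t in \<F>. y t \<in> pts N" "\<And>t. y t a = x a" "\<And>b. b < N \<Longrightarrow> ((\<lambda>t. y t b) \<longlongrightarrow> x b) \<F>"
  shows "((\<lambda>t. if r t = x a then pd h a x else (h ((y t)(a := r t)) - h (y t)) / (r t - x a))
    \<longlongrightarrow> pd h a x) \<F>"
proof (rule tendstoI)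
  fix e :: real assume "e > 0"
  then obtain d where d: "d > 0" "cube N x d \<subseteq> U"
    "\<And>y. y \<in> cube N x d \<Longrightarrow> \<bar>pd h a y - pd h a x\<bar> < e"
    using continuous_on_cube[OF smooth_on_continuous[OF smooth_on_pd[OF h a]] x] by blast
  have "\<forall>\<^sub>F t in \<F>. \<forall>b\<in>{..<N}. dist (y t b) (x b) < d"
    by (intro eventually_ball_finite ballI tendstoD[OF y(3)] d(1)) auto
  moreover have "\<forall>\<^sub>F t in \<F>. dist (r t) (x a) < d"
    by (rule tendstoD[OF r d(1)])
  ultimately show "\<forall>\<^sub>F t in \<F>. dist (if r t = x a then pd h a x
      else (h ((y t)(a := r t)) - h (y t)) / (r t - x a)) (pd h a x) < e"
    using y(1)
  proof eventually_elim
    case (elim t)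
    then have yt: "y t \<in> cube N x d" by (auto simp: cube_def dist_real_def)
    have segment: "(y t)(a := s) \<in> cube N x d" if "s \<in> closed_segment (y t a) (r t)" for s
      using that elim d(1) by (intro cube_update[OF yt a])
        (auto simp: y(2) closed_segment_eq_real_ivl dist_real_def split: if_splits)
    obtain s where s: "s \<in> closed_segment (y t a) (r t)"
      "h ((y t)(a := r t)) - h (y t) = (r t - y t a) * pd h a ((y t)(a := s))"
      using pd_mean_value[OF h a, of "y t" "r t"] segment d(2) by blast
    show ?case
      using d(3)[OF segment[OF s(1)]] s(2) \<open>e > 0\<close> by (simp add: y(2) dist_real_def)
  qed
qed

lemma DERIV_coordinate_increment:
  assumes h: "smooth_on N U h" and x: "x \<in> U" and a: "a < N"
    and r: "(r has_real_derivative r') (at 0)" "r 0 = x a"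
    and y: "\<forall>\<^sub>F t in at 0. y t \<in> pts N" "\<And>t. y t a = x a" "\<And>b. b < N \<Longrightarrow> ((\<lambda>t. y t b) \<longlongrightarrow> x b) (at 0)"
  shows "((\<lambda>t. h ((y t)(a := r t)) - h (y t)) has_real_derivative r' * pd h a x) (at 0)"
proof -
  define f where "f t = h ((y t)(a := r t)) - h (y t)" for t
  define q where "q t = (if r t = x a then pd h a x else f t / (r t - x a))" for t
  have f: "f t = (r t - r 0) * q t" for t
    using r(2) fun_upd_triv[of "y t" a] y(2)[of t] by (simp add: q_def f_def)
  have "(r \<longlongrightarrow> x a) (at 0)"
    using DERIV_isCont[OF r(1)] r(2) by (simp add: isCont_def)
  then have "(q \<longlongrightarrow> pd h a x) (at 0)"
    unfolding q_def[abs_def] f_def using h x a y by (intro difference_quotient_tendsto)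
  with r(1) have "((\<lambda>t. (r t - r 0) / t * q t) \<longlongrightarrow> r' * pd h a x) (at 0)"
    by (intro tendsto_mult) (simp_all add: has_field_derivative_iff)
  then have "(f has_real_derivative r' * pd h a x) (at 0)"
    using f[of 0] by (simp add: has_field_derivative_iff f[abs_def])
  then show ?thesis by (simp add: f_def[abs_def])
qed

theorem chain_rule:
  assumes h: "smooth_on N U h" and c0: "c 0 \<in> U" and cN: "\<forall>\<^sub>F t in nhds 0. c t \<in> pts N"
    and c: "\<And>a. a < N \<Longrightarrow> ((\<lambda>t. c t a) has_real_derivative c' a) (at 0)"
  shows "((\<lambda>t. h (c t)) has_real_derivative (\<Sum>a<N. c' a * pd h a (c 0))) (at 0)"
proof -
  define z where "z a t = (\<lambda>b. if b < a then c t b else c 0 b)" for a t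
  have z_Suc: "z (Suc a) t = (z a t)(a := c t a)" for a t
    by (auto simp: z_def fun_eq_iff)
  have step: "((\<lambda>t. h (z (Suc a) t) - h (z a t)) has_real_derivative c' a * pd h a (c 0)) (at 0)"
    if a: "a < N" for a
    unfolding z_Suc
  proof (rule DERIV_coordinate_increment[OF h c0 a c[OF a]])
    have "\<forall>\<^sub>F t in nhds 0. z a t \<in> pts N"
      using cN by eventually_elim (use U_subset_pts[OF c0] in \<open>auto simp: z_def pts_def\<close>)
    then show "\<forall>\<^sub>F t in at 0. z a t \<in> pts N"
      by (simp add: eventually_nhds_conv_at)
    show "((\<lambda>t. z a t b) \<longlongrightarrow> c 0 b) (at 0)" if "b < N" for b
      using DERIV_isCont[OF c[OF that]] by (cases "b < a") (simp_all add: z_def isCont_def)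
  qed (simp_all add: z_def)
  have "((\<lambda>t. h (c 0) + (\<Sum>a<N. h (z (Suc a) t) - h (z a t))) has_real_derivative
      (\<Sum>a<N. c' a * pd h a (c 0))) (at 0)"
    using DERIV_add[OF DERIV_const DERIV_sum[of "{..<N}", OF step]] by simp
  moreover have "\<forall>\<^sub>F t in nhds 0. h (c 0) + (\<Sum>a<N. h (z (Suc a) t) - h (z a t)) = h (c t)"
    using cN
  proof eventually_elim
    case (elim t)
    then have "z N t = c t" using U_subset_pts[OF c0] by (auto simp: z_def pts_def)
    moreover have "z 0 t = c 0" by (simp add: z_def)
    ultimately show ?case using sum_lessThan_telescope[of "\<lambda>a. h (z a t)" N] by simp
  qed
  ultimately show ?thesis by (simp add: DERIV_cong_ev[OF refl _ refl])
qed

lemma smooth_on_coordinate: "smooth_on N U (\<lambda>x. x b)"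
proof -
  have "smooth_upto (Suc n) (\<lambda>x. x b)" for n
  proof (rule smooth_upto_SucI)
    show "continuous_on U (\<lambda>x. x b)"
      by (rule continuous_on_product_then_coordinatewise) simp
    show "((\<lambda>t. (x(a := x a + t)) b) has_real_derivative (if b = a then 1 else 0)) (at 0)" for x a
      by (rule DERIV_coordinate_line)
  qed (rule smooth_upto_const)
  then show ?thesis
    unfolding smooth_on_iff_upto using smooth_upto_SucD by blast
qed

end

locale smooth_map = dom: coordinate_domain M U + cod: coordinate_domain N V
  for M U N V +
  fixes \<phi> :: "pt \<Rightarrow> pt"
  assumes maps: "x \<in> U \<Longrightarrow> \<phi> x \<in> V"
    and smooth: "b < N \<Longrightarrow> smooth_on M U (\<lambda>x. \<phi> x b)"
begin

lemma DERIV_compose: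
  assumes h: "smooth_on N V h" and x: "x \<in> U" and a: "a < M"
  shows "((\<lambda>t. h (\<phi> (x(a := x a + t)))) has_real_derivative
    (\<Sum>b<N. pd (\<lambda>x. \<phi> x b) a x * pd h b (\<phi> x))) (at 0)"
proof -
  have "\<forall>\<^sub>F t in nhds 0. \<phi> (x(a := x a + t)) \<in> pts N"
    using dom.eventually_coordinate_line[OF x a]
    by eventually_elim (intro cod.U_subset_pts maps)
  then show ?thesis
    using cod.chain_rule[OF h, of "\<lambda>t. \<phi> (x(a := x a + t))" "\<lambda>b. pd (\<lambda>x. \<phi> x b) a x"] maps[OF x]
      dom.smooth_on_DERIV[OF smooth x a] by simp
qed

lemma pd_compose:
  "smooth_on N V h \<Longrightarrow> x \<in> U \<Longrightarrow> a < M \<Longrightarrow>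
    pd (\<lambda>x. h (\<phi> x)) a x = (\<Sum>b<N. pd (\<lambda>x. \<phi> x b) a x * pd h b (\<phi> x))"
  by (rule pd_eqI) (rule DERIV_compose)

lemma smooth_on_compose:
  assumes "smooth_on N V h"
  shows "smooth_on M U (\<lambda>x. h (\<phi> x))"
proof -
  have "continuous_on U (\<lambda>x. \<phi> x b)" for b
  proof (cases "b < N")
    case False
    then have "\<phi> x b = 0" if "x \<in> U" for x
      using cod.U_subset_pts[OF maps[OF that]] by (simp add: pts_def)
    then show ?thesis by (simp cong: continuous_on_cong)
  qed (rule dom.smooth_on_continuous[OF smooth])
  then have \<phi>: "continuous_on U \<phi>"
    by (rule continuous_on_coordinatewise_then_product)
  have "dom.smooth_upto n (\<lambda>x. h (\<phi> x))" for n
    using assms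
  proof (induction n arbitrary: h)
    case (Suc n)
    show ?case
    proof (rule dom.smooth_upto_SucI)
      show "continuous_on U (\<lambda>x. h (\<phi> x))"
        using maps
        by (intro continuous_on_compose2[OF cod.smooth_on_continuous[OF Suc.prems] \<phi>]) auto
      show "((\<lambda>t. h (\<phi> (x(a := x a + t)))) has_real_derivative
          (\<Sum>b<N. pd (\<lambda>x. \<phi> x b) a x * pd h b (\<phi> x))) (at 0)" if "x \<in> U" "a < M" for x a
        using Suc.prems that by (rule DERIV_compose)
      show "dom.smooth_upto n (\<lambda>x. \<Sum>b<N. pd (\<lambda>x. \<phi> x b) a x * pd h b (\<phi> x))" if a: "a < M" for a
      proof -
        have "dom.smooth_upto n (\<lambda>x. pd (\<lambda>x. \<phi> x b) a x * pd h b (\<phi> x))" if "b < N" for b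
          using dom.smooth_on_pd[OF smooth[OF that] a] cod.smooth_on_pd[OF Suc.prems that]
          by (intro dom.smooth_upto_mult Suc.IH) (simp_all add: dom.smooth_on_iff_upto)
        then show ?thesis by (intro dom.smooth_upto_sum) auto
      qed
    qed
  qed simp
  then show ?thesis by (simp add: dom.smooth_on_iff_upto)
qed

end

section \<open>Vector fields\<close>

definition coord_vec :: "nat \<Rightarrow> pt" where
  "coord_vec a = (\<lambda>b. if b = a then 1 else 0)"

definition add_scaled :: "vfield \<Rightarrow> (pt \<Rightarrow> real) \<Rightarrow> vfield \<Rightarrow> vfield" where
  "add_scaled X f Y = (\<lambda>x a. X x a + f x * Y x a)"

lemma add_scaled_apply: "add_scaled X f Y x a = X x a + f x * Y x a"
  by (simp add: add_scaled_def)

lemma coord_vec_pts: "a < N \<Longrightarrow> coord_vec a \<in> pts N"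
  by (auto simp: coord_vec_def pts_def)

lemma ddir_add_scaled: "ddir N (add_scaled X f Y) h x = ddir N X h x + f x * ddir N Y h x"
  by (simp add: ddir_def add_scaled_def sum_distrib_left sum.distrib distrib_right mult.assoc)

lemma lie_antisym: "lie N Y X x e = - lie N X Y x e"
  by (simp add: lie_def)

context coordinate_domain
begin

definition smooth_field :: "vfield \<Rightarrow> bool" where
  "smooth_field X \<longleftrightarrow> range X \<subseteq> pts N \<and> (\<forall>a<N. smooth_on N U (\<lambda>x. X x a))"

lemma smooth_field_pts: "smooth_field X \<Longrightarrow> X x \<in> pts N"
  by (auto simp: smooth_field_def)

lemma smooth_field_component:
  assumes "smooth_field X"
  shows "smooth_on N U (\<lambda>x. X x a)"
proof (cases "a < N")
  case True
  then show ?thesis using assms by (simp add: smooth_field_def)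
next
  case False
  then have "X x a = 0" for x
    using smooth_field_pts[OF assms] by (simp add: pts_def)
  then show ?thesis by (simp add: smooth_on_const)
qed

lemma smooth_field_const: "v \<in> pts N \<Longrightarrow> smooth_field (\<lambda>x. v)"
  by (auto simp: smooth_field_def smooth_on_const)

lemma smooth_field_add_scaled:
  assumes "smooth_field X" "smooth_on N U f" "smooth_field Y"
  shows "smooth_field (add_scaled X f Y)"
  unfolding smooth_field_def add_scaled_def
  using smooth_field_pts[OF assms(1)] smooth_field_pts[OF assms(3)]
  by (auto simp: pts_def intro!: smooth_on_add smooth_on_mult assms
      smooth_field_component[OF assms(1)] smooth_field_component[OF assms(3)])

lemma ddir_cong:
  "x \<in> U \<Longrightarrow> X x = X' x \<Longrightarrow> (\<And>y. y \<in> U \<Longrightarrow> f y = h y) \<Longrightarrow> ddir N X f x = ddir N X' h x"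
  unfolding ddir_def by (intro sum.cong refl arg_cong2[of _ _ _ _ "(*)"] pd_cong) auto

lemma ddir_const: "ddir N X (\<lambda>x. c) x = 0"
  by (simp add: ddir_def pd_const)

lemma ddir_add:
  "smooth_on N U f \<Longrightarrow> smooth_on N U h \<Longrightarrow> x \<in> U \<Longrightarrow>
    ddir N X (\<lambda>y. f y + h y) x = ddir N X f x + ddir N X h x"
  by (simp add: ddir_def pd_add distrib_left sum.distrib)

lemma ddir_diff:
  "smooth_on N U f \<Longrightarrow> smooth_on N U h \<Longrightarrow> x \<in> U \<Longrightarrow>
    ddir N X (\<lambda>y. f y - h y) x = ddir N X f x - ddir N X h x"
  using ddir_add[of "\<lambda>y. f y - h y" h] by (simp add: smooth_on_diff)

lemma ddir_mult:
  "smooth_on N U f \<Longrightarrow> smooth_on N U h \<Longrightarrow> x \<in> U \<Longrightarrow>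
    ddir N X (\<lambda>y. f y * h y) x = ddir N X f x * h x + f x * ddir N X h x"
  by (simp add: ddir_def pd_mult sum_distrib_left sum_distrib_right sum.distrib distrib_left
      mult_ac)

lemma ddir_sum:
  "finite S \<Longrightarrow> (\<And>i. i \<in> S \<Longrightarrow> smooth_on N U (q i)) \<Longrightarrow> x \<in> U \<Longrightarrow>
    ddir N X (\<lambda>y. \<Sum>i\<in>S. q i y) x = (\<Sum>i\<in>S. ddir N X (q i) x)"
  by (induction S rule: finite_induct) (simp_all add: ddir_const ddir_add smooth_on_sum)

lemma smooth_on_ddir: "smooth_field X \<Longrightarrow> smooth_on N U h \<Longrightarrow> smooth_on N U (ddir N X h)"
  unfolding ddir_def[abs_def]
  by (intro smooth_on_sum smooth_on_mult smooth_field_component[of X] smooth_on_pd) auto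

lemma smooth_field_lie:
  assumes X: "smooth_field X" and Y: "smooth_field Y"
  shows "smooth_field (lie N X Y)"
  unfolding smooth_field_def lie_def
  using smooth_on_ddir[OF X smooth_field_component[OF Y]]
    smooth_on_ddir[OF Y smooth_field_component[OF X]]
  by (auto simp: pts_def intro!: smooth_on_diff)

lemma ddir_ddir:
  assumes "smooth_field Y" "smooth_on N U h" "x \<in> U"
  shows "ddir N X (ddir N Y h) x =
    (\<Sum>b<N. ddir N X (\<lambda>y. Y y b) x * pd h b x) + (\<Sum>b<N. \<Sum>a<N. X x a * Y x b * pd (pd h b) a x)"
proof -
  have "ddir N X (ddir N Y h) x = (\<Sum>b<N. ddir N X (\<lambda>y. Y y b * pd h b y) x)"
    unfolding ddir_def[of N Y h, abs_def]
    using assms by (intro ddir_sum smooth_on_mult smooth_field_component[of Y] smooth_on_pd) auto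
  also have "\<dots> = (\<Sum>b<N. ddir N X (\<lambda>y. Y y b) x * pd h b x + Y x b * ddir N X (pd h b) x)"
    using assms by (intro sum.cong refl ddir_mult smooth_field_component[of Y] smooth_on_pd) auto
  finally show ?thesis
    by (simp add: sum.distrib ddir_def[of N X "pd h _"] sum_distrib_left mult_ac)
qed

theorem ddir_commutator:
  assumes X: "smooth_field X" and Y: "smooth_field Y" and h: "smooth_on N U h" and x: "x \<in> U"
  shows "ddir N X (ddir N Y h) x - ddir N Y (ddir N X h) x = ddir N (lie N X Y) h x"
proof -
  have "(\<Sum>b<N. \<Sum>a<N. X x a * Y x b * pd (pd h b) a x)
      = (\<Sum>b<N. \<Sum>a<N. Y x a * X x b * pd (pd h b) a x)"
    by (subst sum.swap) (simp add: pd_commute[OF h x] mult_ac)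
  moreover have "ddir N (lie N X Y) h x
      = (\<Sum>b<N. ddir N X (\<lambda>y. Y y b) x * pd h b x) - (\<Sum>b<N. ddir N Y (\<lambda>y. X y b) x * pd h b x)"
    unfolding ddir_def[of N "lie N X Y"] by (simp add: lie_def sum_subtractf left_diff_distrib)
  ultimately show ?thesis
    by (simp add: ddir_ddir[OF X h x] ddir_ddir[OF Y h x])
qed

lemma ddir_const_field_eqI:
  assumes h: "smooth_on N U h" and x: "x \<in> U" and v: "v \<in> pts N"
    and D: "((\<lambda>t. h (\<lambda>a. x a + t * v a)) has_real_derivative d) (at 0)"
  shows "ddir N (\<lambda>y. v) h x = d"
proof -
  have "((\<lambda>t. h (\<lambda>a. x a + t * v a))
      has_real_derivative (\<Sum>a<N. v a * pd h a (\<lambda>a. x a + 0 * v a))) (at 0)"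
  proof (rule chain_rule[OF h])
    show "((\<lambda>t. x a + t * v a) has_real_derivative v a) (at 0)" for a
      by (auto intro!: derivative_eq_intros)
  qed (use x v U_subset_pts[OF x] in \<open>auto simp: pts_def\<close>)
  then show ?thesis using DERIV_unique D by (auto simp: ddir_def)
qed

end

section \<open>Inverses of arrays and linear maps\<close>

definition array_mat :: "nat \<Rightarrow> (nat \<Rightarrow> nat \<Rightarrow> real) \<Rightarrow> real mat" where
  "array_mat n A = mat n n (\<lambda>(i, j). A i j)"

definition array_inverse :: "nat \<Rightarrow> (nat \<Rightarrow> nat \<Rightarrow> real) \<Rightarrow> nat \<Rightarrow> nat \<Rightarrow> real" where
  "array_inverse n A i j
      = inverse (Determinant.det (array_mat n A)) * adj_mat (array_mat n A) $$ (i, j)"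

lemma array_mat_carrier: "array_mat n A \<in> carrier_mat n n"
  by (simp add: array_mat_def)

lemma det_array_mat_nonzero:
  assumes "\<And>v. v \<in> pts n \<Longrightarrow> lin_map n A v = (\<lambda>_. 0) \<Longrightarrow> v = (\<lambda>_. 0)"
  shows "Determinant.det (array_mat n A) \<noteq> 0"
proof
  assume "Determinant.det (array_mat n A) = 0"
  then obtain v where v: "v \<in> carrier_vec n" "v \<noteq> 0\<^sub>v n" "array_mat n A *\<^sub>v v = 0\<^sub>v n"
    using det_0_iff_vec_prod_zero[OF array_mat_carrier] by blast
  define w where "w b = (if b < n then v $ b else 0)" for b
  have kernel: "lin_map n A w a = 0" for a
  proof (cases "a < n")
    case True
    then have "(array_mat n A *\<^sub>v v) $ a = lin_map n A w a"
      using v(1) by (simp add: lin_map_def array_mat_def w_def scalar_prod_def lessThan_atLeast0)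
    then show ?thesis using v(3) True by simp
  qed (simp add: lin_map_def)
  have "w = (\<lambda>_. 0)"
    using kernel by (intro assms[of w]) (auto simp: w_def pts_def)
  then have "v $ b = 0" if "b < n" for b
    using that w_def[of b] by simp
  then have "v = 0\<^sub>v n"
    using v(1) by (intro eq_vecI) auto
  with v(2) show False ..
qed

lemma array_inverse:
  assumes det: "Determinant.det (array_mat n A) \<noteq> 0" and ij: "i < n" "j < n"
  shows "(\<Sum>m<n. A i m * array_inverse n A m j) = (if i = j then 1 else 0)"
    and "(\<Sum>m<n. array_inverse n A i m * A m j) = (if i = j then 1 else 0)"
proof -
  note adj = adj_mat[OF array_mat_carrier, of n A]
  have "(\<Sum>m<n. A i m * adj_mat (array_mat n A) $$ (m, j))
      = (array_mat n A * adj_mat (array_mat n A)) $$ (i, j)"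
    "(\<Sum>m<n. adj_mat (array_mat n A) $$ (i, m) * A m j)
        = (adj_mat (array_mat n A) * array_mat n A) $$ (i, j)"
    using ij adj(1) by (simp_all add: array_mat_def scalar_prod_def lessThan_atLeast0)
  then show "(\<Sum>m<n. A i m * array_inverse n A m j) = (if i = j then 1 else 0)"
    "(\<Sum>m<n. array_inverse n A i m * A m j) = (if i = j then 1 else 0)"
    using det ij adj(2,3)
    by (simp_all add: array_inverse_def mult.assoc mult.left_commute[of _ "inverse _"]
        flip: sum_distrib_left)
qed

lemma lin_map_pts: "lin_map n A v \<in> pts n"
  by (simp add: lin_map_def pts_def)

lemma lin_map_lin_map_id:
  assumes "\<And>i j. i < n \<Longrightarrow> j < n \<Longrightarrow> (\<Sum>m<n. A i m * B m j) = (if i = j then 1 else 0)" and "v \<in> pts n"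
  shows "lin_map n A (lin_map n B v) = v"
proof
  fix b
  show "lin_map n A (lin_map n B v) b = v b"
  proof (cases "b < n")
    case True
    have "lin_map n A (lin_map n B v) b = (\<Sum>c<n. (\<Sum>a<n. A b a * B a c) * v c)"
      using True unfolding lin_map_def
      by (simp add: sum_distrib_left sum_distrib_right mult.assoc) (rule sum.swap)
    also have "\<dots> = v b"
      using True by (simp add: assms(1) if_distrib[of "\<lambda>z. z * _"] cong: if_cong)
    finally show ?thesis .
  next
    case False
    then show ?thesis using assms(2) by (simp add: lin_map_def pts_def)
  qed
qed

lemma lin_map_array_inverse:
  assumes "Determinant.det (array_mat n A) \<noteq> 0" "v \<in> pts n"
  shows "lin_map n A (lin_map n (array_inverse n A) v) = v"
    and "lin_map n (array_inverse n A) (lin_map n A v) = v"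
  using assms by (auto intro!: lin_map_lin_map_id simp: array_inverse)

context coordinate_domain
begin

lemma smooth_on_det:
  assumes "\<And>i j. i < n \<Longrightarrow> j < n \<Longrightarrow> smooth_on N U (\<lambda>x. m x i j)"
  shows "smooth_on N U (\<lambda>x. Determinant.det (array_mat n (m x)))"
proof -
  have "smooth_on N U (\<lambda>x. \<Sum>p\<in>{p. p permutes {0..<n}}. signof p * (\<Prod>i\<in>{0..<n}. m x i (p i)))"
    using assms by (intro smooth_on_sum smooth_on_mult smooth_on_const smooth_on_prod)
        (auto dest: permutes_in_image)
  moreover have "Determinant.det (array_mat n (m x))
      = (\<Sum>p\<in>{p. p permutes {0..<n}}. signof p * (\<Prod>i\<in>{0..<n}. m x i (p i)))" for x
    by (auto simp: array_mat_def Determinant.det_def dest: permutes_in_image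
        intro!: sum.cong prod.cong)
  ultimately show ?thesis by simp
qed

lemma smooth_on_array_inverse:
  assumes m: "\<And>i j. i < n \<Longrightarrow> j < n \<Longrightarrow> smooth_on N U (\<lambda>x. m x i j)"
    and det: "\<And>x. x \<in> U \<Longrightarrow> Determinant.det (array_mat n (m x)) \<noteq> 0"
    and ij: "i < n" "j < n"
  shows "smooth_on N U (\<lambda>x. array_inverse n (m x) i j)"
proof -
  have minor: "mat_delete (array_mat n (m x)) j i = array_mat (n - 1)
      (\<lambda>a b. m x (if a < j then a else Suc a) (if b < i then b else Suc b))" for x
    by (auto simp: mat_delete_def array_mat_def intro!: eq_matI)
  have "array_inverse n (m x) i j = inverse (Determinant.det (array_mat n (m x)))
      * ((-1) ^ (j + i) * Determinant.det (mat_delete (array_mat n (m x)) j i))" for x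
    using ij by (simp add: array_inverse_def adj_mat_def cofactor_def array_mat_def)
  then show ?thesis
    unfolding minor using m det
    by (auto intro!: smooth_on_mult smooth_on_inverse smooth_on_const smooth_on_det)
qed

end

section \<open>Metrics\<close>

lemma gval_linear_left:
  "gval N g x (\<lambda>a. v a + c * v' a) w = gval N g x v w + c * gval N g x v' w"
  by (simp add: gval_def sum.distrib sum_distrib_left algebra_simps)

lemma gval_linear_right:
  "gval N g x v (\<lambda>a. w a + c * w' a) = gval N g x v w + c * gval N g x v w'"
  by (simp add: gval_def sum.distrib sum_distrib_left algebra_simps)

lemma gval_diff_left: "gval N g x (\<lambda>a. v a - v' a) w = gval N g x v w - gval N g x v' w"
  using gval_linear_left[of N g x v "-1" v' w] by simp

abbreviation lower :: "nat \<Rightarrow> metric \<Rightarrow> pt \<Rightarrow> pt \<Rightarrow> pt" where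
  "lower N g x \<equiv> lin_map N (g x)"

lemma gval_lower: "gval N g x v w = (\<Sum>a<N. v a * lower N g x w a)"
  by (simp add: gval_def lin_map_def sum_distrib_left mult_ac)

lemma gval_coord_vec_left: "a < N \<Longrightarrow> gval N g x (coord_vec a) w = lower N g x w a"
  by (simp add: gval_lower coord_vec_def if_distrib[of "\<lambda>z. z * _"] cong: if_cong)

locale smooth_metric = coordinate_domain N U for N U +
  fixes g :: metric
  assumes g_sym: "x \<in> U \<Longrightarrow> a < N \<Longrightarrow> b < N \<Longrightarrow> g x a b = g x b a"
    and smooth_g: "a < N \<Longrightarrow> b < N \<Longrightarrow> smooth_on N U (\<lambda>x. g x a b)"
    and nondegenerate: "x \<in> U \<Longrightarrow> v \<in> pts N \<Longrightarrow> (\<And>w. w \<in> pts N \<Longrightarrow> gval N g x v w = 0) \<Longrightarrow> v = (\<lambda>_. 0)"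
begin

lemma gval_sym: "x \<in> U \<Longrightarrow> gval N g x v w = gval N g x w v"
  unfolding gval_def by (subst sum.swap) (auto intro!: sum.cong simp: g_sym)

lemma gval_lower_left: "x \<in> U \<Longrightarrow> gval N g x v w = (\<Sum>a<N. w a * lower N g x v a)"
  by (subst gval_sym) (simp_all add: gval_lower)

lemma gval_eqI:
  assumes x: "x \<in> U" and v: "v \<in> pts N" "v' \<in> pts N"
    and eq: "\<And>w. w \<in> pts N \<Longrightarrow> gval N g x v w = gval N g x v' w"
  shows "v = v'"
proof -
  have "(\<lambda>a. v a - v' a) = (\<lambda>_. 0)"
    using v by (intro nondegenerate[OF x]) (auto simp: pts_def gval_diff_left eq)
  then show ?thesis by (simp add: fun_eq_iff)
qed

lemma smooth_on_gval: "smooth_field X \<Longrightarrow> smooth_field Y \<Longrightarrow> smooth_on N U (\<lambda>x. gval N g x (X x) (Y x))"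
  unfolding gval_def by (intro smooth_on_sum smooth_on_mult smooth_g smooth_field_component) auto

lemma det_metric_nonzero:
  assumes "x \<in> U"
  shows "Determinant.det (array_mat N (g x)) \<noteq> 0"
proof (rule det_array_mat_nonzero)
  fix v assume v: "v \<in> pts N" and zero: "lower N g x v = (\<lambda>_. 0)"
  have "gval N g x v w = 0" for w
    using gval_lower_left[OF assms, of v w] by (simp add: zero)
  with assms v show "v = (\<lambda>_. 0)" by (rule nondegenerate)
qed

lemma ginv_eq_array_inverse:
  assumes x: "x \<in> U"
  shows "ginv N g x = (\<lambda>b c. if b < N \<and> c < N then array_inverse N (g x) b c else 0)"
  unfolding ginv_def
proof (rule the_equality)
  note inv = array_inverse[OF det_metric_nonzero[OF x]]
  show "(\<forall>a c. N \<le> a \<or> N \<le> c \<longrightarrow> (if a < N \<and> c < N then array_inverse N (g x) a c else 0) = 0) \<and>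
    (\<forall>a<N. \<forall>c<N. (\<Sum>b<N. g x a b * (if b < N \<and> c < N then array_inverse N (g x) b c else 0))
        = (if a = c then 1 else 0))"
    by (auto simp: inv)
  fix h assume h: "(\<forall>a c. N \<le> a \<or> N \<le> c \<longrightarrow> h a c = 0) \<and>
    (\<forall>a<N. \<forall>c<N. (\<Sum>b<N. g x a b * h b c) = (if a = c then 1 else 0))"
  have "h b c = array_inverse N (g x) b c" if "b < N" "c < N" for b c
  proof -
    have "lower N g x (\<lambda>b. h b c) = coord_vec c"
      using h that by (auto simp: lin_map_def coord_vec_def fun_eq_iff)
    then have "(\<lambda>b. h b c) = lin_map N (array_inverse N (g x)) (coord_vec c)"
      using lin_map_array_inverse(2)[OF det_metric_nonzero[OF x], of "\<lambda>b. h b c"] h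
      by (simp add: pts_def)
    then have "h b c = lin_map N (array_inverse N (g x)) (coord_vec c) b"
      by (rule fun_cong)
    then show ?thesis
      using that by (simp add: lin_map_def coord_vec_def if_distrib[of "\<lambda>z. _ * z"] cong: if_cong)
  qed
  with h show "h = (\<lambda>b c. if b < N \<and> c < N then array_inverse N (g x) b c else 0)"
    by (auto simp: fun_eq_iff)
qed

lemma ginv_inverse:
  "x \<in> U \<Longrightarrow> a < N \<Longrightarrow> c < N \<Longrightarrow> (\<Sum>b<N. g x a b * ginv N g x b c) = (if a = c then 1 else 0)"
  by (simp add: ginv_eq_array_inverse array_inverse det_metric_nonzero)

lemma smooth_on_ginv:
  assumes "b < N" "c < N"
  shows "smooth_on N U (\<lambda>x. ginv N g x b c)"
proof (rule smooth_on_cong)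
  show "smooth_on N U (\<lambda>x. array_inverse N (g x) b c)"
    using smooth_g det_metric_nonzero assms by (rule smooth_on_array_inverse)
qed (simp add: ginv_eq_array_inverse assms)

lemma smooth_metric_subset:
  assumes "openin (top_of_set (pts N)) V" "V \<subseteq> U"
  shows "smooth_metric N V g"
proof
  show "openin (top_of_set (pts N)) V" by fact
  show "g x a b = g x b a" if "x \<in> V" "a < N" "b < N" for x a b
    using g_sym that assms(2) by blast
  show "smooth_on N V (\<lambda>x. g x a b)" if "a < N" "b < N" for a b
    using smooth_g[OF that] assms(2) by (rule smooth_on_subset)
  show "v = (\<lambda>_. 0)" if "x \<in> V" "v \<in> pts N" "\<And>w. w \<in> pts N \<Longrightarrow> gval N g x v w = 0" for x v
    using subsetD[OF assms(2) that(1)] that(2,3) by (rule nondegenerate)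
qed

end

section \<open>The Levi-Civita connection\<close>

lemma conn_pts: "conn N g X Y x \<in> pts N"
  by (simp add: conn_def pts_def)

lemma conn_expand:
  "conn N g X Y x = (\<lambda>e. if e < N
    then ddir N X (\<lambda>y. Y y e) x + (\<Sum>a<N. \<Sum>b<N. chr N g e a b x * X x a * Y x b) else 0)"
  by (simp add: conn_def ddir_def fun_eq_iff distrib_left sum.distrib sum_distrib_left mult_ac)

lemma conn_add_scaled_left:
  "conn N g (add_scaled X f Y) Z = add_scaled (conn N g X Z) f (conn N g Y Z)"
  by (simp add: conn_def add_scaled_def fun_eq_iff distrib_right sum.distrib
      sum_distrib_left mult_ac)

lemma (in coordinate_domain) conn_cong:
  assumes "x \<in> U" "X x = X' x" "\<And>y. y \<in> U \<Longrightarrow> Y y = Y' y"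
  shows "conn N g X Y x = conn N g X' Y' x"
proof -
  have "ddir N X (\<lambda>y. Y y e) x = ddir N X' (\<lambda>y. Y' y e) x" for e
    using assms by (intro ddir_cong) auto
  then show ?thesis by (simp add: conn_expand assms(2) assms(3)[OF assms(1)] cong: if_cong)
qed

context smooth_metric
begin

lemma smooth_on_chr1: "a < N \<Longrightarrow> b < N \<Longrightarrow> c < N \<Longrightarrow> smooth_on N U (chr1 g a b c)"
  unfolding chr1_def[abs_def] divide_inverse
  by (intro smooth_on_mult smooth_on_const smooth_on_add smooth_on_diff smooth_on_pd smooth_g)

lemma smooth_on_chr: "e < N \<Longrightarrow> a < N \<Longrightarrow> b < N \<Longrightarrow> smooth_on N U (chr N g e a b)"
  unfolding chr_def[abs_def]
  by (intro smooth_on_sum smooth_on_mult smooth_on_ginv smooth_on_chr1) auto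

lemma smooth_field_conn:
  assumes X: "smooth_field X" and Y: "smooth_field Y"
  shows "smooth_field (conn N g X Y)"
proof -
  have "smooth_on N U (\<lambda>x. conn N g X Y x e)" if "e < N" for e
    using that unfolding conn_expand
    by (simp, intro smooth_on_add smooth_on_ddir[OF X] smooth_field_component[OF Y] smooth_on_sum
        smooth_on_mult smooth_on_chr smooth_field_component[OF X]) auto
  then show ?thesis
    using conn_pts by (auto simp: smooth_field_def)
qed

lemma lower_chr:
  assumes "x \<in> U" "c < N"
  shows "lower N g x (\<lambda>e. chr N g e a b x) c = chr1 g a b c x"
proof -
  have "(\<Sum>e<N. g x c e * chr N g e a b x)
      = (\<Sum>d<N. (\<Sum>e<N. g x c e * ginv N g x e d) * chr1 g a b d x)"
    unfolding chr_def sum_distrib_left sum_distrib_right by (subst sum.swap) (simp add: mult.assoc)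
  also have "\<dots> = chr1 g a b c x"
    using assms by (simp add: ginv_inverse if_distrib[of "\<lambda>z. z * _"] cong: if_cong)
  finally show ?thesis using assms(2) by (simp add: lin_map_def)
qed

lemma pd_g_sym: "x \<in> U \<Longrightarrow> a < N \<Longrightarrow> b < N \<Longrightarrow> c < N \<Longrightarrow> pd (\<lambda>y. g y b c) a x = pd (\<lambda>y. g y c b) a x"
  by (intro pd_cong g_sym)

lemma chr_sym: "x \<in> U \<Longrightarrow> a < N \<Longrightarrow> b < N \<Longrightarrow> chr N g e a b x = chr N g e b a x"
  unfolding chr_def chr1_def using pd_g_sym[of x _ a b] by (auto intro!: sum.cong)

lemma chr1_add_chr1: "x \<in> U \<Longrightarrow> a < N \<Longrightarrow> b < N \<Longrightarrow> c < N \<Longrightarrow>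
    chr1 g a b c x + chr1 g a c b x = pd (\<lambda>y. g y b c) a x"
  unfolding chr1_def using pd_g_sym[of x a b c] by (simp add: field_simps)

lemma gval_conn:
  assumes x: "x \<in> U"
  shows "gval N g x (conn N g X Y x) w = gval N g x (\<lambda>e. ddir N X (\<lambda>y. Y y e) x) w
    + (\<Sum>a<N. \<Sum>b<N. \<Sum>c<N. chr1 g a b c x * X x a * Y x b * w c)"
proof -
  have "lower N g x (\<lambda>e. \<Sum>a<N. \<Sum>b<N. chr N g e a b x * X x a * Y x b) c
      = (\<Sum>a<N. \<Sum>b<N. chr1 g a b c x * X x a * Y x b)" if "c < N" for c
  proof -
    have "lower N g x (\<lambda>e. \<Sum>a<N. \<Sum>b<N. chr N g e a b x * X x a * Y x b) c
        = (\<Sum>e<N. \<Sum>a<N. \<Sum>b<N. g x c e * chr N g e a b x * X x a * Y x b)"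
      using that by (simp add: lin_map_def sum_distrib_left mult.assoc)
    also have "\<dots> = (\<Sum>a<N. \<Sum>b<N. (\<Sum>e<N. g x c e * chr N g e a b x) * X x a * Y x b)"
      unfolding sum_distrib_right by (subst sum.swap, subst (2) sum.swap) (rule refl)
    finally show ?thesis
      using lower_chr[OF x that] that by (simp add: lin_map_def)
  qed
  then have "gval N g x (\<lambda>e. \<Sum>a<N. \<Sum>b<N. chr N g e a b x * X x a * Y x b) w
      = (\<Sum>c<N. \<Sum>a<N. \<Sum>b<N. chr1 g a b c x * X x a * Y x b * w c)"
    by (simp add: gval_lower_left[OF x] sum_distrib_left mult_ac)
  also have "\<dots> = (\<Sum>a<N. \<Sum>b<N. \<Sum>c<N. chr1 g a b c x * X x a * Y x b * w c)"
    by (subst sum.swap, subst (2) sum.swap) (rule refl)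
  finally show ?thesis
    unfolding conn_expand by (simp add: gval_def distrib_left distrib_right sum.distrib)
qed

lemma ddir_gval:
  assumes Y: "smooth_field Y" and Z: "smooth_field Z" and x: "x \<in> U"
  shows "ddir N X (\<lambda>y. gval N g y (Y y) (Z y)) x
    = (\<Sum>a<N. \<Sum>b<N. \<Sum>c<N. pd (\<lambda>y. g y b c) a x * X x a * Y x b * Z x c)
      + gval N g x (\<lambda>e. ddir N X (\<lambda>y. Y y e) x) (Z x)
      + gval N g x (Y x) (\<lambda>e. ddir N X (\<lambda>y. Z y e) x)"
proof -
  note smooth = smooth_field_component[OF Y] smooth_field_component[OF Z]
  have summand: "smooth_on N U (\<lambda>y. g y b c * Y y b * Z y c)" if "b < N" "c < N" for b c
    using that by (intro smooth_on_mult smooth_g smooth)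
  have "ddir N X (\<lambda>y. gval N g y (Y y) (Z y)) x
      = (\<Sum>b<N. ddir N X (\<lambda>y. \<Sum>c<N. g y b c * Y y b * Z y c) x)"
    unfolding gval_def by (intro ddir_sum smooth_on_sum summand x) auto
  also have "\<dots> = (\<Sum>b<N. \<Sum>c<N. ddir N X (\<lambda>y. g y b c * Y y b * Z y c) x)"
    by (intro sum.cong refl ddir_sum summand x) auto
  also have "\<dots> = (\<Sum>b<N. \<Sum>c<N. ddir N X (\<lambda>y. g y b c) x * Y x b * Z x c
      + g x b c * ddir N X (\<lambda>y. Y y b) x * Z x c + g x b c * Y x b * ddir N X (\<lambda>y. Z y c) x)"
    by (intro sum.cong refl) (simp add: ddir_mult smooth smooth_g smooth_on_mult x algebra_simps)
  also have "\<dots> = (\<Sum>b<N. \<Sum>c<N. \<Sum>a<N. pd (\<lambda>y. g y b c) a x * X x a * Y x b * Z x c)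
      + gval N g x (\<lambda>e. ddir N X (\<lambda>y. Y y e) x) (Z x)
      + gval N g x (Y x) (\<lambda>e. ddir N X (\<lambda>y. Z y e) x)"
    by (simp add: gval_def sum.distrib ddir_def[of N X "\<lambda>y. g y _ _"] sum_distrib_left
        sum_distrib_right mult_ac)
  also have "(\<Sum>b<N. \<Sum>c<N. \<Sum>a<N. pd (\<lambda>y. g y b c) a x * X x a * Y x b * Z x c)
      = (\<Sum>a<N. \<Sum>b<N. \<Sum>c<N. pd (\<lambda>y. g y b c) a x * X x a * Y x b * Z x c)"
    by (subst (2) sum.swap, subst sum.swap) (rule refl)
  finally show ?thesis .
qed

lemma metric_compatible:
  assumes "smooth_field Y" "smooth_field Z" and x: "x \<in> U"
  shows "ddir N X (\<lambda>y. gval N g y (Y y) (Z y)) x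
    = gval N g x (conn N g X Y x) (Z x) + gval N g x (Y x) (conn N g X Z x)"
proof -
  have "(\<Sum>a<N. \<Sum>b<N. \<Sum>c<N. pd (\<lambda>y. g y b c) a x * X x a * Y x b * Z x c)
      = (\<Sum>a<N. \<Sum>b<N. \<Sum>c<N. (chr1 g a b c x + chr1 g a c b x) * X x a * Y x b * Z x c)"
    by (simp add: chr1_add_chr1[OF x])
  also have "\<dots> = (\<Sum>a<N. \<Sum>b<N. \<Sum>c<N. chr1 g a b c x * X x a * Y x b * Z x c)
      + (\<Sum>a<N. \<Sum>b<N. \<Sum>c<N. chr1 g a c b x * X x a * Z x c * Y x b)"
    by (simp add: sum.distrib algebra_simps)
  also have "(\<Sum>a<N. \<Sum>b<N. \<Sum>c<N. chr1 g a c b x * X x a * Z x c * Y x b)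
      = (\<Sum>a<N. \<Sum>b<N. \<Sum>c<N. chr1 g a b c x * X x a * Z x b * Y x c)"
    by (intro sum.cong refl sum.swap)
  finally show ?thesis
    using assms by (simp add: ddir_gval gval_conn gval_sym[OF x, of "Y x"])
qed

lemma torsion_free:
  assumes x: "x \<in> U"
  shows "conn N g X Y x e - conn N g Y X x e = lie N X Y x e"
proof -
  have "(\<Sum>a<N. \<Sum>b<N. chr N g e a b x * X x a * Y x b)
      = (\<Sum>a<N. \<Sum>b<N. chr N g e a b x * Y x a * X x b)"
    by (subst sum.swap) (simp add: chr_sym[OF x, of _ _ e] mult_ac)
  then show ?thesis by (simp add: conn_expand lie_def)
qed

theorem koszul:
  assumes X: "smooth_field X" and Y: "smooth_field Y" and Z: "smooth_field Z" and x: "x \<in> U"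
  shows "2 * gval N g x (conn N g X Y x) (Z x)
    = ddir N X (\<lambda>y. gval N g y (Y y) (Z y)) x + ddir N Y (\<lambda>y. gval N g y (X y) (Z y)) x
      - ddir N Z (\<lambda>y. gval N g y (X y) (Y y)) x
      + gval N g x (lie N X Y x) (Z x) - gval N g x (lie N X Z x) (Y x)
      - gval N g x (lie N Y Z x) (X x)"
proof -
  have lie: "gval N g x (lie N X Y x) w = gval N g x (conn N g X Y x) w
      - gval N g x (conn N g Y X x) w" for X Y w
    using gval_diff_left[of N g x "conn N g X Y x" "conn N g Y X x" w]
        torsion_free[OF x, of X Y] by simp
  show ?thesis
    unfolding lie metric_compatible[OF Y Z x] metric_compatible[OF X Z x]
        metric_compatible[OF X Y x]
    by (simp add: gval_sym[OF x, of "X x"] gval_sym[OF x, of "Y x"])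
qed

lemma lie_const: "lie N (\<lambda>_. u) (\<lambda>_. v) x = (\<lambda>_. 0)"
  by (simp add: lie_def ddir_const fun_eq_iff)

lemma koszul_const:
  assumes "u \<in> pts N" "v \<in> pts N" "w \<in> pts N" "x \<in> U"
  shows "2 * gval N g x (conn N g (\<lambda>_. u) (\<lambda>_. v) x) w
    = ddir N (\<lambda>_. u) (\<lambda>y. gval N g y v w) x + ddir N (\<lambda>_. v) (\<lambda>y. gval N g y u w) x
      - ddir N (\<lambda>_. w) (\<lambda>y. gval N g y u v) x"
  using koszul[OF assms(1-3)[THEN smooth_field_const] assms(4)] by (simp add: lie_const gval_def)

lemma conn_add_scaled_right:
  assumes Y: "smooth_field Y" and f: "smooth_on N U f" and Z: "smooth_field Z" and x: "x \<in> U"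
  shows "conn N g X (add_scaled Y f Z) x e
    = conn N g X Y x e + f x * conn N g X Z x e + ddir N X f x * Z x e"
proof (cases "e < N")
  case True
  have "ddir N X (\<lambda>y. Y y e + f y * Z y e) x
      = ddir N X (\<lambda>y. Y y e) x + (ddir N X f x * Z x e + f x * ddir N X (\<lambda>y. Z y e) x)"
    using x by (simp add: ddir_add ddir_mult smooth_on_mult f smooth_field_component Y Z)
  then show ?thesis
    using True by (simp add: conn_expand add_scaled_apply distrib_left
        sum.distrib sum_distrib_left mult_ac)
next
  case False
  then show ?thesis using smooth_field_pts[OF Z, of x] by (simp add: conn_expand pts_def)
qed

end

section \<open>Curvature\<close>

definition riem :: "nat \<Rightarrow> metric \<Rightarrow> vfield \<Rightarrow> vfield \<Rightarrow> vfield \<Rightarrow> vfield" where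
  "riem N g X Y Z = (\<lambda>x e. conn N g X (conn N g Y Z) x e - conn N g Y (conn N g X Z) x e
     - conn N g (lie N X Y) Z x e)"

lemma curv_eq_gval_riem: "curv N g X Y Z W x = gval N g x (riem N g X Y Z x) (W x)"
  by (simp add: curv_def riem_def)

context smooth_metric
begin

lemma riem_antisym: "riem N g Y X Z x e = - riem N g X Y Z x e"
proof -
  have "lie N Y X = add_scaled (\<lambda>x e. 0) (\<lambda>x. - 1) (lie N X Y)"
    using lie_antisym[of N Y X] by (simp add: add_scaled_def fun_eq_iff)
  moreover have "conn N g (\<lambda>x e. 0) Z x e = 0"
    by (simp add: conn_def)
  ultimately have "conn N g (lie N Y X) Z x e = - conn N g (lie N X Y) Z x e"
    by (simp only: conn_add_scaled_left add_scaled_apply)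
  then show ?thesis by (simp add: riem_def)
qed

lemma lie_add_scaled_left:
  assumes "smooth_field X" "smooth_on N U f" "smooth_field Y" "x \<in> U"
  shows "lie N (add_scaled X f Y) Z x
      = (\<lambda>e. add_scaled (lie N X Z) f (lie N Y Z) x e - ddir N Z f x * Y x e)"
proof
  fix e
  have lie: "lie N V Z x e = conn N g V Z x e - conn N g Z V x e" for V
    by (simp add: torsion_free assms(4))
  show "lie N (add_scaled X f Y) Z x e = add_scaled (lie N X Z) f (lie N Y Z) x e
      - ddir N Z f x * Y x e"
    unfolding lie add_scaled_apply conn_add_scaled_left conn_add_scaled_right[OF assms]
    by (simp add: algebra_simps)
qed

lemma smooth_field_riem:
  assumes X: "smooth_field X" and Y: "smooth_field Y" and Z: "smooth_field Z"
  shows "smooth_field (riem N g X Y Z)"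
proof -
  note fields = smooth_field_conn[OF X smooth_field_conn[OF Y Z]]
      smooth_field_conn[OF Y smooth_field_conn[OF X Z]]
    smooth_field_conn[OF smooth_field_lie[OF X Y] Z]
  have "riem N g X Y Z x \<in> pts N" for x
    using fields[THEN smooth_field_pts, of x] by (simp add: riem_def pts_def)
  then show ?thesis
    unfolding smooth_field_def
    by (auto simp: riem_def intro!: smooth_on_diff fields[THEN smooth_field_component])
qed

lemma riem_add_scaled_first:
  assumes X: "smooth_field X" and f: "smooth_on N U f" and Y: "smooth_field Y"
    and Z: "smooth_field Z" and W: "smooth_field W" and x: "x \<in> U"
  shows "riem N g (add_scaled X f Y) Z W x e = riem N g X Z W x e + f x * riem N g Y Z W x e"
proof -
  have "conn N g Z (conn N g (add_scaled X f Y) W) x e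
      = conn N g Z (conn N g X W) x e + f x * conn N g Z (conn N g Y W) x e
      + ddir N Z f x * conn N g Y W x e"
    unfolding conn_add_scaled_left using assms by (intro conn_add_scaled_right smooth_field_conn)
  moreover have "conn N g (lie N (add_scaled X f Y) Z) W x e
      = conn N g (lie N X Z) W x e + f x * conn N g (lie N Y Z) W x e
      - ddir N Z f x * conn N g Y W x e"
  proof -
    have "conn N g (lie N (add_scaled X f Y) Z) W x
        = conn N g (add_scaled (add_scaled (lie N X Z) f (lie N Y Z)) (\<lambda>x. - ddir N Z f x) Y) W x"
      using lie_add_scaled_left[OF X f Y x, of Z] by (intro conn_cong[OF x])
          (simp_all add: fun_eq_iff add_scaled_apply)
    then show ?thesis by (simp add: conn_add_scaled_left add_scaled_apply)
  qed
  ultimately show ?thesis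
    by (simp add: riem_def conn_add_scaled_left[of N g X] add_scaled_apply algebra_simps)
qed

lemma conn_conn_add_scaled:
  assumes X: "smooth_field X" and Y: "smooth_field Y" and Z: "smooth_field Z"
    and f: "smooth_on N U f" and W: "smooth_field W" and x: "x \<in> U"
  shows "conn N g X (conn N g Y (add_scaled Z f W)) x e
    = conn N g X (conn N g Y Z) x e + f x * conn N g X (conn N g Y W) x e
      + ddir N X f x * conn N g Y W x e + ddir N Y f x * conn N g X W x e
      + ddir N X (ddir N Y f) x * W x e"
proof -
  let ?V = "add_scaled (conn N g Y Z) f (conn N g Y W)"
  have "conn N g X (conn N g Y (add_scaled Z f W)) x = conn N g X (add_scaled ?V (ddir N Y f) W) x"
    by (intro conn_cong[OF x])
        (simp_all add: fun_eq_iff add_scaled_apply conn_add_scaled_right[OF Z f W])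
  moreover have "smooth_field ?V"
    using assms by (intro smooth_field_add_scaled smooth_field_conn)
  ultimately show ?thesis
    using assms by (simp add: conn_add_scaled_right smooth_field_conn smooth_on_ddir
        add_scaled_apply algebra_simps)
qed

lemma riem_add_scaled_third:
  assumes X: "smooth_field X" and Y: "smooth_field Y" and Z: "smooth_field Z"
    and f: "smooth_on N U f" and W: "smooth_field W" and x: "x \<in> U"
  shows "riem N g X Y (add_scaled Z f W) x e = riem N g X Y Z x e + f x * riem N g X Y W x e"
  by (simp add: riem_def ddir_commutator[OF X Y f x, symmetric]
      conn_conn_add_scaled[OF X Y Z f W x] conn_conn_add_scaled[OF Y X Z f W x]
      conn_add_scaled_right[OF Z f W x] algebra_simps)

end

section \<open>Tensor fields and their covariant derivatives\<close>

context coordinate_domain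
begin

abbreviation smooth_fields :: "vfield set" where
  "smooth_fields \<equiv> Collect smooth_field"

lemma smooth_fields_nth: "set Xs \<subseteq> smooth_fields \<Longrightarrow> j < length Xs \<Longrightarrow> smooth_field (Xs ! j)"
  using nth_mem by blast

definition tensor_field :: "nat \<Rightarrow> tensor \<Rightarrow> bool" where
  "tensor_field n T \<longleftrightarrow> (\<forall>Xs. length Xs = n \<longrightarrow> set Xs \<subseteq> smooth_fields \<longrightarrow>
     smooth_on N U (T Xs) \<and>
     (\<forall>j<n. \<forall>f Y. smooth_on N U f \<longrightarrow> smooth_field Y \<longrightarrow>
        (\<forall>x\<in>U. T (Xs[j := add_scaled (Xs ! j) f Y]) x = T Xs x + f x * T (Xs[j := Y]) x)))"

lemma tensor_field_smooth:
  "tensor_field n T \<Longrightarrow> length Xs = n \<Longrightarrow> set Xs \<subseteq> smooth_fields \<Longrightarrow> smooth_on N U (T Xs)"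
  by (simp add: tensor_field_def)

lemma tensor_field_add_scaled:
  assumes "tensor_field n T" "length Xs = n" "set Xs \<subseteq> smooth_fields" "j < n" "x \<in> U"
    and "smooth_field Y" "smooth_on N U f" "smooth_field Z"
  shows "T (Xs[j := add_scaled Y f Z]) x = T (Xs[j := Y]) x + f x * T (Xs[j := Z]) x"
proof -
  have "length (Xs[j := Y]) = n" "set (Xs[j := Y]) \<subseteq> smooth_fields"
    using assms(2,6) set_update_subsetI[OF assms(3), of Y j] by auto
  then have "T ((Xs[j := Y])[j := add_scaled (Xs[j := Y] ! j) f Z]) x
      = T (Xs[j := Y]) x + f x * T ((Xs[j := Y])[j := Z]) x"
    using assms unfolding tensor_field_def by blast
  then show ?thesis using assms(2,4) by simp
qed

lemma tensor_field_slot_pointwise: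
  assumes T: "tensor_field n T" and Xs: "length Xs = n" "set Xs \<subseteq> smooth_fields" and j: "j < n"
    and x: "x \<in> U" and Y: "smooth_field Y" and Z: "smooth_field Z" and eq: "Y x = Z x"
  shows "T (Xs[j := Y]) x = T (Xs[j := Z]) x"
proof -
  define H where "H a = (\<lambda>x b. if b < a then Y x b else Z x b)" for a
  have "smooth_on N U (\<lambda>x. H a x b)" for a b
    using smooth_field_component[OF Y, of b] smooth_field_component[OF Z, of b]
    by (cases "b < a") (simp_all add: H_def)
  then have H: "smooth_field (H a)" for a
    using smooth_field_pts[OF Y] smooth_field_pts[OF Z]
    by (auto simp: smooth_field_def H_def pts_def)
  have H_Suc: "H (Suc a) = add_scaled (H a) (\<lambda>x. Y x a - Z x a) (\<lambda>x. coord_vec a)" for a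
    by (auto simp: H_def add_scaled_def coord_vec_def fun_eq_iff less_Suc_eq)
  have "T (Xs[j := H a]) x = T (Xs[j := Z]) x" if "a \<le> N" for a
    using that
  proof (induction a)
    case (Suc a)
    then have "T (Xs[j := H (Suc a)]) x = T (Xs[j := H a]) x
        + (Y x a - Z x a) * T (Xs[j := (\<lambda>x. coord_vec a)]) x"
      unfolding H_Suc
      by (intro tensor_field_add_scaled[OF T Xs j x H] smooth_on_diff smooth_field_const
        smooth_field_component[OF Y] smooth_field_component[OF Z] coord_vec_pts) simp
    then show ?case using Suc by (simp add: eq)
  qed (simp add: H_def)
  moreover have "H N = Y"
    using smooth_field_pts[OF Y] smooth_field_pts[OF Z] by (auto simp: H_def pts_def fun_eq_iff)
  ultimately show ?thesis by force
qed

lemma tensor_field_pointwise: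
  assumes T: "tensor_field n T" and Xs: "length Xs = n" "set Xs \<subseteq> smooth_fields"
    and Ys: "length Ys = n" "set Ys \<subseteq> smooth_fields"
    and x: "x \<in> U" and eq: "map (\<lambda>X. X x) Xs = map (\<lambda>X. X x) Ys"
  shows "T Xs x = T Ys x"
proof -
  have "T (take m Ys @ drop m Xs) x = T Xs x" if "m \<le> n" for m
    using that
  proof (induction m)
    case (Suc m)
    let ?Zs = "take m Ys @ drop m Xs"
    have Zs: "length ?Zs = n" "set ?Zs \<subseteq> smooth_fields"
      using Xs Ys Suc.prems by (auto dest: in_set_takeD in_set_dropD)
    have "take (Suc m) Ys @ drop (Suc m) Xs = ?Zs[m := Ys ! m]" "?Zs = ?Zs[m := Xs ! m]"
      using Suc.prems Xs(1) Ys(1)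
      by (auto simp: take_Suc_conv_app_nth list_update_append simp flip: Cons_nth_drop_Suc)
    moreover have "T (?Zs[m := Ys ! m]) x = T (?Zs[m := Xs ! m]) x"
    proof (rule tensor_field_slot_pointwise[OF T Zs _ x])
      show "(Ys ! m) x = (Xs ! m) x"
        using arg_cong[OF eq, of "\<lambda>vs. vs ! m"] Xs(1) Ys(1) Suc.prems by simp
    qed (use Xs Ys Suc.prems in \<open>auto intro: smooth_fields_nth\<close>)
    ultimately show ?case using Suc by simp
  qed simp
  from this[of n] show ?thesis using Xs Ys by simp
qed

end

context smooth_metric
begin

lemma smooth_on_covD:
  assumes T: "tensor_field n T" and Xs: "length Xs = n" "set Xs \<subseteq> smooth_fields"
    and Y: "smooth_field Y"
  shows "smooth_on N U (covD N g T Y Xs)"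
proof -
  have "smooth_on N U (T (Xs[j := conn N g Y (Xs ! j)]))" if "j < n" for j
    using that Xs Y by (intro tensor_field_smooth[OF T] set_update_subsetI)
        (auto intro!: smooth_field_conn smooth_fields_nth)
  then show ?thesis
    unfolding covD_def[abs_def] using Xs(1)
    by (intro smooth_on_diff smooth_on_sum smooth_on_ddir[OF Y] tensor_field_smooth[OF T Xs]) auto
qed

lemma covD_add_scaled_direction:
  assumes T: "tensor_field n T" and Xs: "length Xs = n" "set Xs \<subseteq> smooth_fields"
    and fields: "smooth_field Y" "smooth_on N U f" "smooth_field Z" and x: "x \<in> U"
  shows "covD N g T (add_scaled Y f Z) Xs x = covD N g T Y Xs x + f x * covD N g T Z Xs x"
proof -
  have "T (Xs[j := conn N g (add_scaled Y f Z) (Xs ! j)]) x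
      = T (Xs[j := conn N g Y (Xs ! j)]) x + f x * T (Xs[j := conn N g Z (Xs ! j)]) x"
    if "j < n" for j
    unfolding conn_add_scaled_left using that Xs fields
    by (intro tensor_field_add_scaled[OF T Xs that x] smooth_field_conn smooth_fields_nth) auto
  then show ?thesis
    using Xs(1) by (simp add: covD_def ddir_add_scaled sum.distrib sum_distrib_left algebra_simps)
qed

lemma tensor_field_conn_add_scaled:
  assumes T: "tensor_field n T" and Xs: "length Xs = n" "set Xs \<subseteq> smooth_fields"
    and ij: "i < n" "j < n"
    and Y: "smooth_field Y" and f: "smooth_on N U f" and Z: "smooth_field Z" and x: "x \<in> U"
  defines "Xs' \<equiv> Xs[j := add_scaled (Xs ! j) f Z]"
  shows "T (Xs'[i := conn N g Y (Xs' ! i)]) x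
    = T (Xs[i := conn N g Y (Xs ! i)]) x
      + f x * T ((Xs[j := Z])[i := conn N g Y (Xs[j := Z] ! i)]) x
      + (if i = j then ddir N Y f x * T (Xs[j := Z]) x else 0)"
proof (cases "i = j")
  case True
  have Xj: "smooth_field (Xs ! j)" using Xs ij by (simp add: smooth_fields_nth)
  note conn = smooth_field_conn[OF Y Xj] smooth_field_conn[OF Y Z]
  let ?V = "add_scaled (conn N g Y (Xs ! j)) f (conn N g Y Z)"
  have V: "smooth_field ?V" using conn f by (intro smooth_field_add_scaled)
  have "T (Xs[j := conn N g Y (add_scaled (Xs ! j) f Z)]) x
      = T (Xs[j := add_scaled ?V (ddir N Y f) Z]) x"
    using conn_add_scaled_right[OF Xj f Z x, of Y]
    by (intro tensor_field_slot_pointwise[OF T Xs ij(2) x] smooth_field_conn[OF Y]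
        smooth_field_add_scaled Xj f Z V smooth_on_ddir[OF Y f])
      (simp add: fun_eq_iff add_scaled_apply)
  also have "\<dots> = T (Xs[j := ?V]) x + ddir N Y f x * T (Xs[j := Z]) x"
    by (rule tensor_field_add_scaled[OF T Xs ij(2) x V smooth_on_ddir[OF Y f] Z])
  also have "T (Xs[j := ?V]) x = T (Xs[j := conn N g Y (Xs ! j)]) x
      + f x * T (Xs[j := conn N g Y Z]) x"
    by (rule tensor_field_add_scaled[OF T Xs ij(2) x conn(1) f conn(2)])
  finally show ?thesis using True Xs(1) ij by (simp add: Xs'_def)
next
  case False
  let ?Ys = "Xs[i := conn N g Y (Xs ! i)]"
  have "set ?Ys \<subseteq> smooth_fields"
    using Xs ij Y by (intro set_update_subsetI) (auto intro!: smooth_field_conn smooth_fields_nth)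
  then have "T (?Ys[j := add_scaled (Xs ! j) f Z]) x
      = T (?Ys[j := Xs ! j]) x + f x * T (?Ys[j := Z]) x"
    using Xs ij f Z x by (intro tensor_field_add_scaled[OF T]) (auto intro!: smooth_fields_nth)
  then show ?thesis
    using False by (simp add: Xs'_def list_update_swap[of i j])
qed

lemma covD_add_scaled_slot:
  assumes T: "tensor_field n T" and Xs: "length Xs = n" "set Xs \<subseteq> smooth_fields" and j: "j < n"
    and Y: "smooth_field Y" and f: "smooth_on N U f" and Z: "smooth_field Z" and x: "x \<in> U"
  shows "covD N g T Y (Xs[j := add_scaled (Xs ! j) f Z]) x
      = covD N g T Y Xs x + f x * covD N g T Y (Xs[j := Z]) x"
proof -
  have XsZ: "smooth_on N U (T (Xs[j := Z]))"
    using Xs Z by (intro tensor_field_smooth[OF T] set_update_subsetI) auto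
  have "ddir N Y (T (Xs[j := add_scaled (Xs ! j) f Z])) x
      = ddir N Y (\<lambda>y. T Xs y + f y * T (Xs[j := Z]) y) x"
    using T Xs j f Z by (intro ddir_cong[OF x refl]) (simp add: tensor_field_def)
  also have "\<dots> = ddir N Y (T Xs) x + ddir N Y f x * T (Xs[j := Z]) x
      + f x * ddir N Y (T (Xs[j := Z])) x"
    using x by (simp add: ddir_add ddir_mult smooth_on_mult f XsZ tensor_field_smooth[OF T Xs])
  finally show ?thesis
    using j Xs(1)
    by (simp add: covD_def tensor_field_conn_add_scaled[OF T Xs _ j Y f Z x]
        sum.distrib sum_distrib_left algebra_simps)
qed

lemma tensor_field_covD:
  assumes T: "tensor_field n T"
  shows "tensor_field (Suc n) (\<lambda>Xs. covD N g T (last Xs) (butlast Xs))"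
  unfolding tensor_field_def
proof (intro allI impI conjI ballI)
  fix Xs :: "vfield list" assume Xs: "length Xs = Suc n" "set Xs \<subseteq> smooth_fields"
  then obtain Ys Y where Xs_eq: "Xs = Ys @ [Y]" and Ys: "length Ys = n" "set Ys \<subseteq> smooth_fields"
    and Y: "smooth_field Y"
    by (cases Xs rule: rev_cases) auto
  show "smooth_on N U (covD N g T (last Xs) (butlast Xs))"
    using smooth_on_covD[OF T Ys Y] by (simp add: Xs_eq)
  fix j f Z x assume j: "j < Suc n" and f: "smooth_on N U f" and Z: "smooth_field Z" and x: "x \<in> U"
  show "covD N g T (last (Xs[j := add_scaled (Xs ! j) f Z]))
      (butlast (Xs[j := add_scaled (Xs ! j) f Z])) x
      = covD N g T (last Xs) (butlast Xs) x
        + f x * covD N g T (last (Xs[j := Z])) (butlast (Xs[j := Z])) x"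
  proof (cases "j = n")
    case True
    then show ?thesis
      using covD_add_scaled_direction[OF T Ys Y f Z x] Ys(1)
      by (simp add: Xs_eq list_update_append nth_append)
  next
    case False
    then show ?thesis
      using covD_add_scaled_slot[OF T Ys _ Y f Z x, of j] j Ys(1)
      by (simp add: Xs_eq list_update_append nth_append)
  qed
qed

lemma tensor_field_curvT: "tensor_field 4 (curvT N g)"
  unfolding tensor_field_def
proof (intro allI impI conjI ballI)
  fix Xs :: "vfield list" assume "length Xs = 4" "set Xs \<subseteq> smooth_fields"
  then obtain A B C D where Xs: "Xs = [A, B, C, D]"
    and fields: "smooth_field A" "smooth_field B" "smooth_field C" "smooth_field D"
    by (auto simp: length_Suc_conv numeral_eq_Suc)
  show "smooth_on N U (curvT N g Xs)"
    using smooth_on_gval[OF smooth_field_riem[OF fields(1-3)] fields(4)]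
    by (simp add: Xs curvT_def curv_eq_gval_riem[abs_def])
  fix j f Y x assume "j < (4::nat)" and Y: "smooth_on N U f" "smooth_field Y" and x: "x \<in> U"
  then consider (A) "j = 0" | (B) "j = 1" | (C) "j = 2" | (D) "j = 3" by linarith
  then show "curvT N g (Xs[j := add_scaled (Xs ! j) f Y]) x
      = curvT N g Xs x + f x * curvT N g (Xs[j := Y]) x"
  proof cases
    case A
    have "riem N g (add_scaled A f Y) B C x = (\<lambda>e. riem N g A B C x e + f x * riem N g Y B C x e)"
      using riem_add_scaled_first fields Y x by blast
    then show ?thesis
      using A by (simp add: Xs curvT_def curv_eq_gval_riem gval_linear_left)
  next
    case B
    have "riem N g A (add_scaled B f Y) C x = (\<lambda>e. riem N g A B C x e + f x * riem N g A Y C x e)"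
      using riem_add_scaled_first[OF fields(2) Y fields(1,3) x]
      by (simp add: riem_antisym[of A] fun_eq_iff)
    then show ?thesis
      using B by (simp add: Xs curvT_def curv_eq_gval_riem gval_linear_left)
  next
    case C
    have "riem N g A B (add_scaled C f Y) x = (\<lambda>e. riem N g A B C x e + f x * riem N g A B Y x e)"
      using riem_add_scaled_third fields Y x by blast
    then show ?thesis
      using C by (simp add: Xs curvT_def curv_eq_gval_riem gval_linear_left numeral_eq_Suc)
  next
    case D
    then show ?thesis
      by (simp add: Xs curvT_def curv_eq_gval_riem add_scaled_def gval_linear_right numeral_eq_Suc)
  qed
qed

theorem tensor_field_nablaR: "tensor_field (4 + l) (nablaR N g l)"
proof (induction l)
  case (Suc l)
  from tensor_field_covD[OF this] show ?case by simp
qed (simp add: tensor_field_curvT)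

lemma nablaR_eq_tensor_at:
  assumes "length Xs = 4 + l" "set Xs \<subseteq> smooth_fields" "x \<in> U"
  shows "nablaR N g l Xs x = tensor_at (nablaR N g l) x (map (\<lambda>X. X x) Xs)"
  unfolding tensor_at_def using assms smooth_field_pts
  by (intro tensor_field_pointwise[OF tensor_field_nablaR])
      (auto intro!: smooth_field_const simp: comp_def)

lemma tensor_at_nablaR_Suc:
  assumes vs: "length vs = 4 + l" "set vs \<subseteq> pts N" and y: "y \<in> pts N" and x: "x \<in> U"
  shows "tensor_at (nablaR N g (Suc l)) x (vs @ [y])
    = ddir N (\<lambda>_. y) (\<lambda>x. tensor_at (nablaR N g l) x vs) x
      - (\<Sum>j<4 + l. tensor_at (nablaR N g l) x (vs[j := conn N g (\<lambda>_. y) (\<lambda>_. vs ! j) x]))"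
proof -
  let ?Xs = "map (\<lambda>v _. v) vs"
  have "nablaR N g l (?Xs[j := conn N g (\<lambda>_. y) (\<lambda>_. vs ! j)]) x
      = tensor_at (nablaR N g l) x (vs[j := conn N g (\<lambda>_. y) (\<lambda>_. vs ! j) x])" if "j < 4 + l" for j
  proof -
    have "smooth_field (conn N g (\<lambda>_. y) (\<lambda>_. vs ! j))"
      using vs y that by (intro smooth_field_conn smooth_field_const) auto
    then have "set (?Xs[j := conn N g (\<lambda>_. y) (\<lambda>_. vs ! j)]) \<subseteq> smooth_fields"
      using vs by (intro set_update_subsetI) (auto intro!: smooth_field_const)
    then show ?thesis
      using vs x by (subst nablaR_eq_tensor_at) (simp_all add: map_update comp_def)
  qed
  then show ?thesis
    unfolding tensor_at_def[of "nablaR N g (Suc l)"] tensor_at_def[of "nablaR N g l" _ vs]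
    using vs(1) by (simp add: covD_def)
qed

lemma tensor_at_curvature:
  assumes uvwz: "u \<in> pts N" "v \<in> pts N" "w \<in> pts N" "z \<in> pts N" and x: "x \<in> U"
  defines "\<Gamma> \<equiv> \<lambda>u v. conn N g (\<lambda>_. u) (\<lambda>_. v)"
  shows "tensor_at (nablaR N g 0) x [u, v, w, z]
    = ddir N (\<lambda>_. u) (\<lambda>y. gval N g y (\<Gamma> v w y) z) x - ddir N (\<lambda>_. v) (\<lambda>y. gval N g y (\<Gamma> u w y) z) x
      - gval N g x (\<Gamma> v w x) (\<Gamma> u z x) + gval N g x (\<Gamma> u w x) (\<Gamma> v z x)"
proof -
  have lie: "conn N g (lie N (\<lambda>_. u) (\<lambda>_. v)) (\<lambda>_. w) x e = 0" for e
    by (simp add: conn_def lie_const)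
  have compat: "ddir N (\<lambda>_. u) (\<lambda>y. gval N g y (\<Gamma> v w y) z) x
      = gval N g x (conn N g (\<lambda>_. u) (\<Gamma> v w) x) z + gval N g x (\<Gamma> v w x) (\<Gamma> u z x)"
    if "v \<in> pts N" for u v
    unfolding \<Gamma>_def using that uvwz x
    by (intro metric_compatible smooth_field_conn smooth_field_const)
  have "tensor_at (nablaR N g 0) x [u, v, w, z]
      = gval N g x (conn N g (\<lambda>_. u) (\<Gamma> v w) x) z - gval N g x (conn N g (\<lambda>_. v) (\<Gamma> u w) x) z"
    by (simp add: tensor_at_def curvT_def curv_eq_gval_riem riem_def lie gval_diff_left \<Gamma>_def)
  then show ?thesis
    using compat[OF uvwz(1), of v] compat[OF uvwz(2), of u] by simp
qed

end

section \<open>Isometries preserve all covariant derivatives of the curvature\<close>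

lemma dmap_eq_ddir: "b < N \<Longrightarrow> dmap N \<phi> x (X x) b = ddir N X (\<lambda>y. \<phi> y b) x"
  by (simp add: dmap_def ddir_def mult.commute)

lemma dmap_pts: "dmap N \<phi> x v \<in> pts N"
  by (simp add: dmap_def pts_def)

locale isometry = dom: smooth_metric N U g + cod: smooth_metric N V g' + smooth_map N U N V \<phi>
    + inv: smooth_map N V N U \<psi>
  for N U V g g' \<phi> \<psi> +
  assumes inverse: "x \<in> U \<Longrightarrow> \<psi> (\<phi> x) = x" "y \<in> V \<Longrightarrow> \<phi> (\<psi> y) = y"
    and isometric: "x \<in> U \<Longrightarrow> v \<in> pts N \<Longrightarrow> w \<in> pts N \<Longrightarrow>
      gval N g' (\<phi> x) (dmap N \<phi> x v) (dmap N \<phi> x w) = gval N g x v w"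
begin

definition push :: "vfield \<Rightarrow> vfield" where
  "push X = (\<lambda>y. dmap N \<phi> (\<psi> y) (X (\<psi> y)))"

lemma push_apply: "x \<in> U \<Longrightarrow> push X (\<phi> x) = dmap N \<phi> x (X x)"
  by (simp add: push_def inverse)

lemma smooth_field_push:
  assumes X: "dom.smooth_field X"
  shows "cod.smooth_field (push X)"
  unfolding cod.smooth_field_def
proof (intro conjI allI impI)
  show "range (push X) \<subseteq> pts N"
    using dmap_pts by (auto simp: push_def)
  show "smooth_on N V (\<lambda>y. push X y b)" if "b < N" for b
    using inv.smooth_on_compose[OF dom.smooth_on_ddir[OF X smooth[OF that]]]
    by (simp add: push_def dmap_eq_ddir that)
qed

lemma ddir_push:
  assumes h: "smooth_on N V h" and x: "x \<in> U"
  shows "ddir N (push X) h (\<phi> x) = ddir N X (\<lambda>x. h (\<phi> x)) x"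
proof -
  have "ddir N X (\<lambda>x. h (\<phi> x)) x = (\<Sum>a<N. \<Sum>b<N. X x a * (pd (\<lambda>x. \<phi> x b) a x * pd h b (\<phi> x)))"
    using x by (simp add: ddir_def pd_compose[OF h] sum_distrib_left)
  also have "\<dots> = (\<Sum>b<N. \<Sum>a<N. X x a * (pd (\<lambda>x. \<phi> x b) a x * pd h b (\<phi> x)))"
    by (rule sum.swap)
  also have "\<dots> = ddir N (push X) h (\<phi> x)"
    using x by (simp add: ddir_def push_apply dmap_def sum_distrib_left sum_distrib_right mult_ac)
  finally show ?thesis ..
qed

lemma lie_push:
  assumes X: "dom.smooth_field X" and Y: "dom.smooth_field Y" and x: "x \<in> U"
  shows "lie N (push X) (push Y) (\<phi> x) = dmap N \<phi> x (lie N X Y x)"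
proof
  fix b
  have "ddir N (push X) (\<lambda>y. push Y y b) (\<phi> x) = ddir N X (ddir N Y (\<lambda>y. \<phi> y b)) x"
    if "b < N" "dom.smooth_field Y" for X Y
  proof -
    have "ddir N (push X) (\<lambda>y. push Y y b) (\<phi> x) = ddir N X (\<lambda>x. push Y (\<phi> x) b) x"
      using cod.smooth_field_component[OF smooth_field_push[OF that(2)]] x by (rule ddir_push)
    also have "\<dots> = ddir N X (ddir N Y (\<lambda>y. \<phi> y b)) x"
      using that by (intro dom.ddir_cong[OF x refl]) (simp add: push_apply dmap_eq_ddir)
    finally show ?thesis .
  qed
  then have "lie N (push X) (push Y) (\<phi> x) b = ddir N (lie N X Y) (\<lambda>y. \<phi> y b) x" if "b < N"
    using that X Y dom.ddir_commutator[OF X Y smooth[OF that] x]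
    by (simp add: lie_def[of N "push X"])
  then show "lie N (push X) (push Y) (\<phi> x) b = dmap N \<phi> x (lie N X Y x) b"
    by (cases "b < N") (simp_all add: dmap_eq_ddir, simp add: lie_def dmap_def)
qed

lemma dmap_surj:
  assumes x: "x \<in> U" and w: "w \<in> pts N"
  shows "dmap N \<phi> x (dmap N \<psi> (\<phi> x) w) = w"
proof
  fix b
  show "dmap N \<phi> x (dmap N \<psi> (\<phi> x) w) b = w b"
  proof (cases "b < N")
    case True
    have "(\<Sum>a<N. pd (\<lambda>y. \<phi> y b) a x * pd (\<lambda>y. \<psi> y a) c (\<phi> x)) = (if b = c then 1 else 0)"
      if "c < N" for c
    proof -
      have "pd (\<lambda>y. \<phi> (\<psi> y) b) c (\<phi> x) = pd (\<lambda>y. y b) c (\<phi> x)"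
        using maps[OF x] that by (rule cod.pd_cong) (simp add: inverse)
      also have "\<dots> = (if b = c then 1 else 0)"
        by (rule pd_eqI[OF DERIV_coordinate_line])
      finally show ?thesis
        using inv.pd_compose[OF smooth[OF True] maps[OF x] that]
        by (simp add: inverse x mult.commute)
    qed
    then have "w b = (\<Sum>c<N. (\<Sum>a<N. pd (\<lambda>y. \<phi> y b) a x * pd (\<lambda>y. \<psi> y a) c (\<phi> x)) * w c)"
      using True by (simp add: if_distrib[of "\<lambda>z. z * _"] cong: if_cong)
    then show ?thesis
      using True unfolding dmap_def
      by (simp add: sum_distrib_left sum_distrib_right mult.assoc) (rule sum.swap)
  qed (use w in \<open>simp add: dmap_def pts_def\<close>)
qed

lemma gval_push:
  "x \<in> U \<Longrightarrow> dom.smooth_field X \<Longrightarrow> dom.smooth_field Y \<Longrightarrow>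
    gval N g' (\<phi> x) (push X (\<phi> x)) (push Y (\<phi> x)) = gval N g x (X x) (Y x)"
  by (simp add: push_apply isometric dom.smooth_field_pts)

lemma conn_push:
  assumes X: "dom.smooth_field X" and Y: "dom.smooth_field Y" and x: "x \<in> U"
  shows "conn N g' (push X) (push Y) (\<phi> x) = dmap N \<phi> x (conn N g X Y x)"
proof (rule cod.gval_eqI[OF maps[OF x] conn_pts dmap_pts])
  fix w assume w: "w \<in> pts N"
  define Z where "Z = (\<lambda>_::pt. dmap N \<psi> (\<phi> x) w)"
  have Z: "dom.smooth_field Z"
    unfolding Z_def by (intro dom.smooth_field_const dmap_pts)
  have push_Z: "push Z (\<phi> x) = w"
    by (simp add: push_apply x Z_def dmap_surj w)
  have ddir_gval_push: "ddir N (push X) (\<lambda>y. gval N g' y (push Y y) (push Z y)) (\<phi> x)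
      = ddir N X (\<lambda>y. gval N g y (Y y) (Z y)) x"
    if "dom.smooth_field Y" "dom.smooth_field Z" for X Y Z
    using that x by (subst ddir_push)
        (auto intro!: cod.smooth_on_gval smooth_field_push dom.ddir_cong simp: gval_push)
  have gval_lie_push: "gval N g' (\<phi> x) (lie N (push X) (push Y) (\<phi> x)) (push Z (\<phi> x))
      = gval N g x (lie N X Y x) (Z x)"
    if "dom.smooth_field X" "dom.smooth_field Y" "dom.smooth_field Z" for X Y Z
    using that x gval_push[OF x dom.smooth_field_lie[OF that(1,2)] that(3)]
    by (simp add: lie_push push_apply)
  have "2 * gval N g' (\<phi> x) (conn N g' (push X) (push Y) (\<phi> x)) (push Z (\<phi> x))
      = 2 * gval N g x (conn N g X Y x) (Z x)"
    unfolding cod.koszul[OF X[THEN smooth_field_push] Y[THEN smooth_field_push]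
        Z[THEN smooth_field_push] maps[OF x]]
      dom.koszul[OF X Y Z x]
    using X Y Z by (simp add: ddir_gval_push gval_lie_push)
  then show "gval N g' (\<phi> x) (conn N g' (push X) (push Y) (\<phi> x)) w
      = gval N g' (\<phi> x) (dmap N \<phi> x (conn N g X Y x)) w"
    using gval_push[OF x dom.smooth_field_conn[OF X Y] Z] by (simp add: push_Z push_apply x)
qed

lemma conn_push_eq_push:
  assumes "dom.smooth_field X" "dom.smooth_field Y" "y \<in> V"
  shows "conn N g' (push X) (push Y) y = push (conn N g X Y) y"
  using conn_push[OF assms(1,2) inv.maps[OF assms(3)]] by (simp add: inverse assms(3) push_def)

lemma riem_push:
  assumes X: "dom.smooth_field X" and Y: "dom.smooth_field Y" and Z: "dom.smooth_field Z"
    and x: "x \<in> U"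
  shows "riem N g' (push X) (push Y) (push Z) (\<phi> x) = dmap N \<phi> x (riem N g X Y Z x)"
proof -
  have nested: "conn N g' (push X) (conn N g' (push Y) (push Z)) (\<phi> x)
      = dmap N \<phi> x (conn N g X (conn N g Y Z) x)"
    if "dom.smooth_field X" "dom.smooth_field Y" for X Y
    using that conn_push[OF that(1) dom.smooth_field_conn[OF that(2) Z] x] Z
    by (subst cod.conn_cong[where Y' = "push (conn N g Y Z)"])
        (simp_all add: maps x conn_push_eq_push)
  have "conn N g' (lie N (push X) (push Y)) (push Z) (\<phi> x) = dmap N \<phi> x (conn N g (lie N X Y) Z x)"
    using conn_push[OF dom.smooth_field_lie[OF X Y] Z x]
    by (subst cod.conn_cong[where X' = "push (lie N X Y)"])
        (simp_all add: maps x lie_push X Y push_apply)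
  then show ?thesis
    using nested[OF X Y] nested[OF Y X]
    by (auto simp: riem_def fun_eq_iff dmap_def sum_subtractf right_diff_distrib)
qed

lemma curvT_push:
  assumes "length Xs = 4" "set Xs \<subseteq> dom.smooth_fields" and x: "x \<in> U"
  shows "curvT N g' (map push Xs) (\<phi> x) = curvT N g Xs x"
proof -
  obtain A B C D where Xs: "Xs = [A, B, C, D]"
    and fields: "dom.smooth_field A" "dom.smooth_field B" "dom.smooth_field C" "dom.smooth_field D"
    using assms(1,2) by (auto simp: length_Suc_conv numeral_eq_Suc)
  show ?thesis
    using gval_push[OF x dom.smooth_field_riem[OF fields(1-3)] fields(4)]
        riem_push[OF fields(1-3) x]
    by (simp add: Xs curvT_def curv_eq_gval_riem push_apply x)
qed

lemma covD_push:
  assumes T': "cod.tensor_field n T'"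
    and natural: "\<And>Xs x. length Xs = n \<Longrightarrow> set Xs \<subseteq> dom.smooth_fields \<Longrightarrow> x \<in> U \<Longrightarrow>
      T' (map push Xs) (\<phi> x) = T Xs x"
    and Xs: "length Xs = n" "set Xs \<subseteq> dom.smooth_fields" and Y: "dom.smooth_field Y" and x: "x \<in> U"
  shows "covD N g' T' (push Y) (map push Xs) (\<phi> x) = covD N g T Y Xs x"
proof -
  have push_Xs: "set (map push Xs) \<subseteq> cod.smooth_fields"
    using Xs(2) smooth_field_push by auto
  have "ddir N (push Y) (T' (map push Xs)) (\<phi> x) = ddir N Y (\<lambda>x. T' (map push Xs) (\<phi> x)) x"
    using cod.tensor_field_smooth[OF T' _ push_Xs] Xs(1) x by (intro ddir_push) auto
  also have "\<dots> = ddir N Y (T Xs) x"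
    using natural[OF Xs] by (intro dom.ddir_cong[OF x refl])
  moreover have "T' ((map push Xs)[j := conn N g' (push Y) (push (Xs ! j))]) (\<phi> x)
      = T (Xs[j := conn N g Y (Xs ! j)]) x" if j: "j < n" for j
  proof -
    have Xj: "dom.smooth_field (Xs ! j)" using Xs j by (simp add: dom.smooth_fields_nth)
    have "T' ((map push Xs)[j := conn N g' (push Y) (push (Xs ! j))]) (\<phi> x)
        = T' ((map push Xs)[j := push (conn N g Y (Xs ! j))]) (\<phi> x)"
      using Xs(1) j x Y Xj
      by (intro cod.tensor_field_slot_pointwise[OF T' _ push_Xs] maps cod.smooth_field_conn
          smooth_field_push dom.smooth_field_conn) (simp_all add: conn_push_eq_push maps)
    also have "\<dots> = T (Xs[j := conn N g Y (Xs ! j)]) x"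
      unfolding map_update[symmetric]
      using Xs Y Xj x by (intro natural set_update_subsetI) (auto intro!: dom.smooth_field_conn)
    finally show ?thesis .
  qed
  ultimately show ?thesis
    using Xs(1) by (simp add: covD_def)
qed

theorem nablaR_push:
  assumes "length Xs = 4 + l" "set Xs \<subseteq> dom.smooth_fields" "x \<in> U"
  shows "nablaR N g' l (map push Xs) (\<phi> x) = nablaR N g l Xs x"
  using assms
proof (induction l arbitrary: Xs x)
  case (Suc l)
  then obtain Ys Y where Xs: "Xs = Ys @ [Y]"
    and Ys: "length Ys = 4 + l" "set Ys \<subseteq> dom.smooth_fields" and Y: "dom.smooth_field Y"
    by (cases Xs rule: rev_cases) auto
  have "covD N g' (nablaR N g' l) (push Y) (map push Ys) (\<phi> x) = covD N g (nablaR N g l) Y Ys x"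
    using cod.tensor_field_nablaR Suc.IH Ys Y Suc.prems(3) by (rule covD_push)
  then show ?case by (simp add: Xs)
qed (simp add: curvT_push)

theorem model_iso_differential:
  assumes x: "x \<in> U"
  shows "model_iso N g x g' (\<phi> x) (\<lambda>b a. pd (\<lambda>y. \<phi> y b) a x) l"
proof -
  have D: "lin_map N (\<lambda>b a. pd (\<lambda>y. \<phi> y b) a x) = dmap N \<phi> x"
    by (simp add: lin_map_def dmap_def fun_eq_iff)
  have "tensor_at (nablaR N g' i) (\<phi> x) (map (dmap N \<phi> x) vs) = tensor_at (nablaR N g i) x vs"
    if vs: "length vs = 4 + i" "set vs \<subseteq> pts N" for i vs
  proof -
    let ?Xs = "map (\<lambda>v _. v) vs"
    have Xs: "length ?Xs = 4 + i" "set ?Xs \<subseteq> dom.smooth_fields"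
      using vs dom.smooth_field_const by auto
    have "tensor_at (nablaR N g' i) (\<phi> x) (map (dmap N \<phi> x) vs)
        = nablaR N g' i (map push ?Xs) (\<phi> x)"
      using Xs smooth_field_push
      by (subst cod.nablaR_eq_tensor_at) (auto simp: comp_def push_apply x maps)
    also have "\<dots> = tensor_at (nablaR N g i) x vs"
      using nablaR_push[OF Xs x] by (simp add: tensor_at_def)
    finally show ?thesis .
  qed
  then show ?thesis
    unfolding model_iso_def D using isometric[OF x] by auto
qed

end

theorem loc_isom_model_iso:
  assumes g: "smooth_metric N (pts N) g" and \<phi>: "loc_isom N g U V \<phi>" and x: "x \<in> U"
  shows "model_iso N g x g (\<phi> x) (\<lambda>b a. pd (\<lambda>y. \<phi> y b) a x) l"
proof -
  interpret smooth_metric N "pts N" g by fact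
  have UV: "openin (top_of_set (pts N)) U" "openin (top_of_set (pts N)) V" and bij: "bij_betw \<phi> U V"
    using \<phi> by (auto simp: loc_isom_def)
  interpret U: smooth_metric N U g
    using UV(1) openin_imp_subset[OF UV(1)] by (rule smooth_metric_subset)
  interpret V: smooth_metric N V g
    using UV(2) openin_imp_subset[OF UV(2)] by (rule smooth_metric_subset)
  interpret isometry N U V g g \<phi> "inv_into U \<phi>"
    using \<phi> bij_betw_imp_surj_on[OF bij] bij_betw_inv_into_left[OF bij]
        bij_betw_inv_into_right[OF bij]
    by unfold_locales (auto simp: loc_isom_def intro: inv_into_into)
  show ?thesis using x by (rule model_iso_differential)
qed

corollary loc_homog_imp_curv_homog:
  assumes "smooth_metric N (pts N) g" "loc_homog N g"
  shows "curv_homog N g l"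
  unfolding curv_homog_def
proof (intro ballI)
  fix P Q assume "P \<in> pts N" "Q \<in> pts N"
  then obtain U V \<phi> where "P \<in> U" "\<phi> P = Q" "loc_isom N g U V \<phi>"
    using assms(2) unfolding loc_homog_def by blast
  then show "\<exists>A. model_iso N g P g Q A l"
    using loc_isom_model_iso[OF assms(1)] by blast
qed

section \<open>The metric and its Christoffel symbols\<close>

locale plane_wave =
  fixes k :: nat and eps :: "nat \<Rightarrow> real" and F :: "nat \<Rightarrow> real \<Rightarrow> real"
  assumes k_pos: "k \<ge> 1"
    and eps_pm: "i \<in> {1..k} \<Longrightarrow> eps i = 1 \<or> eps i = -1"
    and admissible: "admissible k F"
begin

definition N :: nat where "N = 3 * k + 2"

definition I :: "nat set" where "I = {1..k}"

abbreviation "g \<equiv> gF k eps F"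
abbreviation "dF i \<equiv> deriv (F i)"
abbreviation "ddF i \<equiv> deriv (deriv (F i))"

definition v_idx :: "nat \<Rightarrow> nat" where "v_idx j = k + 1 + j"

definition s_idx :: "nat \<Rightarrow> nat" where "s_idx i = 2 * k + 1 + i"

lemma finite_I [simp]: "finite I"
  by (simp add: I_def)

lemma eps_square: "i \<in> I \<Longrightarrow> eps i * eps i = 1"
  using eps_pm by (fastforce simp: I_def)

lemma eps_cancel: "i \<in> I \<Longrightarrow> eps i * (eps i * r) = r"
  by (simp add: eps_square flip: mult.assoc)

lemma smooth_F: "i \<in> I \<Longrightarrow> smooth_fn (F i)"
  and dF_nonzero: "i \<in> I \<Longrightarrow> 1 + dF i u \<noteq> 0"
  and ddF_nonzero: "i \<in> I \<Longrightarrow> ddF i u \<noteq> 0"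
  using admissible by (auto simp: I_def admissible_def smooth_fn_def numeral_2_eq_2 add.commute)

lemma idx_less [simp]:
  "0 < N" "i \<in> I \<Longrightarrow> i < N" "v_idx 0 < N" "i \<in> I \<Longrightarrow> v_idx i < N" "i \<in> I \<Longrightarrow> s_idx i < N"
  by (auto simp: v_idx_def s_idx_def N_def I_def)

lemma idx_neq [simp]:
  "v_idx j \<noteq> 0" "s_idx j \<noteq> 0" "0 \<noteq> v_idx j" "0 \<noteq> s_idx j"
  "i \<in> I \<Longrightarrow> i \<noteq> v_idx j" "i \<in> I \<Longrightarrow> v_idx j \<noteq> i" "i \<in> I \<Longrightarrow> i \<noteq> s_idx j" "i \<in> I \<Longrightarrow> s_idx j \<noteq> i"
  "i \<in> I \<Longrightarrow> j \<in> I \<Longrightarrow> v_idx i \<noteq> s_idx j" "i \<in> I \<Longrightarrow> j \<in> I \<Longrightarrow> s_idx j \<noteq> v_idx i"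
  "j \<in> I \<Longrightarrow> v_idx 0 \<noteq> s_idx j" "j \<in> I \<Longrightarrow> s_idx j \<noteq> v_idx 0"
  "i \<in> I \<Longrightarrow> i \<noteq> 0" "i \<in> I \<Longrightarrow> 0 \<noteq> i"
  "v_idx j \<notin> I" "s_idx j \<notin> I" "0 \<notin> I"
  "v_idx i = v_idx j \<longleftrightarrow> i = j" "s_idx i = s_idx j \<longleftrightarrow> i = j"
  by (auto simp: v_idx_def s_idx_def N_def I_def)

lemma idx_cases [consumes 1, case_names u0 u v0 v s]:
  assumes "a < N"
  obtains "a = 0" | i where "i \<in> I" "a = i" | "a = v_idx 0" | i where "i \<in> I" "a = v_idx i"
    | i where "i \<in> I" "a = s_idx i"
proof -
  consider "a = 0" | "a \<in> I" | "a = v_idx 0" | "a - (k+1) \<in> I" "a = v_idx (a - (k+1))"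
    | "a - (2*k+1) \<in> I" "a = s_idx (a - (2*k+1))"
    using assms unfolding v_idx_def s_idx_def N_def I_def by force
  then show ?thesis using that by cases auto
qed

lemma sum_idx:
  "(\<Sum>a<N. h a) = h 0 + (\<Sum>i\<in>I. h i) + h (v_idx 0) + (\<Sum>i\<in>I. h (v_idx i)) + (\<Sum>i\<in>I. h (s_idx i))"
  for h :: "nat \<Rightarrow> real"
proof -
  have indices: "{..<N} = insert 0 (insert (v_idx 0) (I \<union> (v_idx ` I \<union> s_idx ` I)))"
    by (auto elim: idx_cases)
  have "inj_on v_idx I" "inj_on s_idx I" by (auto simp: inj_on_def)
  moreover have "I \<inter> (v_idx ` I \<union> s_idx ` I) = {}" "v_idx ` I \<inter> s_idx ` I = {}"
    "v_idx 0 \<notin> I \<union> (v_idx ` I \<union> s_idx ` I)" "0 \<notin> insert (v_idx 0) (I \<union> (v_idx ` I \<union> s_idx ` I))"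
    by auto
  ultimately show ?thesis
    unfolding indices by (simp add: sum.union_disjoint sum.reindex)
qed

lemma g_simps [simp]:
  "g x 0 0 = 0"
  "i \<in> I \<Longrightarrow> g x 0 i = 2 * F i (x i) * x (s_idx i)"
  "i \<in> I \<Longrightarrow> g x i 0 = 2 * F i (x i) * x (s_idx i)"
  "i \<in> I \<Longrightarrow> j \<in> I \<Longrightarrow> g x i j = (if i = j then - 2 * x 0 * x (s_idx i) else 0)"
  "g x 0 (v_idx j) = (if j = 0 then 1 else 0)"
  "g x (v_idx j) 0 = (if j = 0 then 1 else 0)"
  "i \<in> I \<Longrightarrow> g x i (v_idx j) = (if i = j then 1 else 0)"
  "i \<in> I \<Longrightarrow> g x (v_idx j) i = (if i = j then 1 else 0)"
  "i \<in> I \<Longrightarrow> j \<in> I \<Longrightarrow> g x (v_idx i) (v_idx j) = 0" "i \<in> I \<Longrightarrow> g x (v_idx i) (v_idx 0) = 0"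
  "i \<in> I \<Longrightarrow> g x (v_idx 0) (v_idx i) = 0" "g x (v_idx 0) (v_idx 0) = 0"
  "i \<in> I \<Longrightarrow> g x 0 (s_idx i) = 0" "i \<in> I \<Longrightarrow> g x (s_idx i) 0 = 0"
  "i \<in> I \<Longrightarrow> j \<in> I \<Longrightarrow> g x j (s_idx i) = 0" "i \<in> I \<Longrightarrow> j \<in> I \<Longrightarrow> g x (s_idx i) j = 0"
  "i \<in> I \<Longrightarrow> g x (v_idx 0) (s_idx i) = 0" "i \<in> I \<Longrightarrow> g x (s_idx i) (v_idx 0) = 0"
  "i \<in> I \<Longrightarrow> j \<in> I \<Longrightarrow> g x (v_idx j) (s_idx i) = 0" "i \<in> I \<Longrightarrow> j \<in> I \<Longrightarrow> g x (s_idx i) (v_idx j) = 0"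
  "i \<in> I \<Longrightarrow> j \<in> I \<Longrightarrow> g x (s_idx i) (s_idx j) = (if i = j then eps i else 0)"
  by (auto simp: gF_def v_idx_def s_idx_def I_def)

lemma lower_simps [simp]:
  "lower N g x w 0 = (\<Sum>i\<in>I. 2 * F i (x i) * x (s_idx i) * w i) + w (v_idx 0)"
  "i \<in> I \<Longrightarrow> lower N g x w i
    = 2 * F i (x i) * x (s_idx i) * w 0 - 2 * x 0 * x (s_idx i) * w i + w (v_idx i)"
  "lower N g x w (v_idx 0) = w 0"
  "i \<in> I \<Longrightarrow> lower N g x w (v_idx i) = w i"
  "i \<in> I \<Longrightarrow> lower N g x w (s_idx i) = eps i * w (s_idx i)"
  by (simp_all add: lin_map_def sum_idx if_distrib[of "\<lambda>z. z * _"] cong: if_cong)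

definition gF_term :: "nat \<Rightarrow> pt \<Rightarrow> pt \<Rightarrow> pt \<Rightarrow> real" where
  "gF_term i x v w = 2 * F i (x i) * x (s_idx i) * (v 0 * w i + v i * w 0)
     - 2 * x 0 * x (s_idx i) * v i * w i + v i * w (v_idx i) + v (v_idx i) * w i
     + eps i * v (s_idx i) * w (s_idx i)"

lemma gval_expand:
  "gval N g x v w = (\<Sum>i\<in>I. gF_term i x v w) + v 0 * w (v_idx 0) + v (v_idx 0) * w 0"
  by (simp add: gval_lower sum_idx gF_term_def sum.distrib sum_subtractf
      sum_distrib_left algebra_simps)

lemma gval_coord_vec: "a < N \<Longrightarrow> gval N g x w (coord_vec a) = lower N g x w a"
  using gval_coord_vec_left[of a N g x w] by (simp add: gval_expand gF_term_def algebra_simps)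

lemma nondegenerate_gF:
  assumes "v \<in> pts N" "\<And>w. w \<in> pts N \<Longrightarrow> gval N g x v w = 0"
  shows "v = (\<lambda>_. 0)"
proof -
  have lower: "lower N g x v b = 0" if "b < N" for b
    using assms(2)[of "coord_vec b"] that by (simp add: gval_coord_vec coord_vec_pts)
  have u0: "v 0 = 0" using lower[of "v_idx 0"] by simp
  have u: "v i = 0" if "i \<in> I" for i using lower[of "v_idx i"] that by simp
  have v0: "v (v_idx 0) = 0" using lower[of 0] u by simp
  have v: "v (v_idx i) = 0" if "i \<in> I" for i using lower[of i] that u0 u by simp
  have s: "v (s_idx i) = 0" if "i \<in> I" for i
    using lower[of "s_idx i"] that eps_square[of i] by auto
  have "v a = 0" for a
  proof (cases "a < N")
    case True
    then show ?thesis by (cases rule: idx_cases) (auto simp: u0 u v0 v s)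
  qed (use assms(1) in \<open>simp add: pts_def\<close>)
  then show ?thesis by blast
qed

sublocale coordinate_domain N "pts N"
  by unfold_locales simp

lemma smooth_on_F: "i \<in> I \<Longrightarrow> smooth_on N (pts N) (\<lambda>x. F i (x i))"
  by (rule smooth_on_smooth_fn[OF smooth_F smooth_on_coordinate])

lemma smooth_on_gF:
  assumes "a < N" "b < N"
  shows "smooth_on N (pts N) (\<lambda>x. g x a b)"
proof -
  have mixed: "smooth_on N (pts N) (\<lambda>x. 2 * F i (x i) * x (2 * k + 1 + i))" if "1 \<le> i" "i \<le> k" for i
    using that by (intro smooth_on_mult smooth_on_const smooth_on_F smooth_on_coordinate)
        (simp add: I_def)
  have cases: "smooth_on N (pts N) (\<lambda>x. if c then p x else q x)"
    if "c \<Longrightarrow> smooth_on N (pts N) p" "\<not> c \<Longrightarrow> smooth_on N (pts N) q" for c p q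
    using that by (cases c) simp_all
  show ?thesis
    unfolding gF_def by (intro cases mixed smooth_on_mult smooth_on_const smooth_on_coordinate) auto
qed

sublocale smooth_metric N "pts N" g
proof unfold_locales
  show "g x a b = g x b a" for x a b
    by (auto simp: gF_def)
  show "smooth_on N (pts N) (\<lambda>x. g x a b)" if "a < N" "b < N" for a b
    using that by (rule smooth_on_gF)
  show "v = (\<lambda>_. 0)" if "x \<in> pts N" "v \<in> pts N" "\<And>w. w \<in> pts N \<Longrightarrow> gval N g x v w = 0" for x v
    using that(2,3) by (rule nondegenerate_gF)
qed

lemma smooth_metric_gF: "smooth_metric (3 * k + 2) (pts (3 * k + 2)) g"
  using smooth_metric_axioms unfolding N_def .

lemma F_line_DERIV:
  assumes "i \<in> I"
  shows "((\<lambda>t. F i (x i + t * u i)) has_real_derivative dF i (x i) * u i) (at 0)"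
    and "((\<lambda>t. dF i (x i + t * u i)) has_real_derivative ddF i (x i) * u i) (at 0)"
proof -
  have line: "((\<lambda>t. x i + t * u i) has_real_derivative u i) (at 0)"
    by (auto intro!: derivative_eq_intros)
  show "((\<lambda>t. F i (x i + t * u i)) has_real_derivative dF i (x i) * u i) (at 0)"
    "((\<lambda>t. dF i (x i + t * u i)) has_real_derivative ddF i (x i) * u i) (at 0)"
    using DERIV_chain2[OF smooth_fn_DERIV line] smooth_F[OF assms]
        smooth_fn_deriv[OF smooth_F[OF assms]]
    by fastforce+
qed

definition gF_term_deriv :: "nat \<Rightarrow> pt \<Rightarrow> pt \<Rightarrow> pt \<Rightarrow> pt \<Rightarrow> real" where
  "gF_term_deriv i x u v w =
     2 * (dF i (x i) * u i * x (s_idx i) + F i (x i) * u (s_idx i)) * (v 0 * w i + v i * w 0)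
     - 2 * (u 0 * x (s_idx i) + x 0 * u (s_idx i)) * v i * w i"

lemma gF_term_DERIV:
  "i \<in> I \<Longrightarrow>
    ((\<lambda>t. gF_term i (\<lambda>a. x a + t * u a) v w) has_real_derivative gF_term_deriv i x u v w) (at 0)"
  unfolding gF_term_def gF_term_deriv_def
  by (auto intro!: derivative_eq_intros F_line_DERIV simp: algebra_simps)

lemma ddir_gval_const:
  assumes "x \<in> pts N" "u \<in> pts N" "v \<in> pts N" "w \<in> pts N"
  shows "ddir N (\<lambda>_. u) (\<lambda>y. gval N g y v w) x = (\<Sum>i\<in>I. gF_term_deriv i x u v w)"
proof (rule ddir_const_field_eqI[OF _ assms(1,2)])
  show "smooth_on N (pts N) (\<lambda>y. gval N g y v w)"
    using assms by (intro smooth_on_gval smooth_field_const)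
  have "((\<lambda>t. \<Sum>i\<in>I. gF_term i (\<lambda>a. x a + t * u a) v w) has_real_derivative
      (\<Sum>i\<in>I. gF_term_deriv i x u v w)) (at 0)"
    by (intro DERIV_sum gF_term_DERIV)
  from DERIV_add[OF DERIV_add[OF this DERIV_const] DERIV_const]
  show "((\<lambda>t. gval N g (\<lambda>a. x a + t * u a) v w) has_real_derivative
      (\<Sum>i\<in>I. gF_term_deriv i x u v w)) (at 0)"
    unfolding gval_expand add_0_right .
qed

definition christoffel_s :: "nat \<Rightarrow> pt \<Rightarrow> pt \<Rightarrow> pt \<Rightarrow> real" where
  "christoffel_s i x v w = x 0 * v i * w i - F i (x i) * (v 0 * w i + v i * w 0)"

definition christoffel1_term :: "nat \<Rightarrow> pt \<Rightarrow> pt \<Rightarrow> pt \<Rightarrow> pt \<Rightarrow> real" where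
  "christoffel1_term i x v w z =
     ((2 * dF i (x i) + 1) * x (s_idx i) * v i * w i
       + F i (x i) * (v i * w (s_idx i) + v (s_idx i) * w i)) * z 0
     + (F i (x i) * (v 0 * w (s_idx i) + v (s_idx i) * w 0) - x (s_idx i) * (v 0 * w i + v i * w 0)
       - x 0 * (v i * w (s_idx i) + v (s_idx i) * w i)) * z i
     + christoffel_s i x v w * z (s_idx i)"

definition christoffel1_term_deriv :: "nat \<Rightarrow> pt \<Rightarrow> pt \<Rightarrow> pt \<Rightarrow> pt \<Rightarrow> pt \<Rightarrow> real" where
  "christoffel1_term_deriv i x u v w z =
     ((2 * ddF i (x i) * u i * x (s_idx i) + (2 * dF i (x i) + 1) * u (s_idx i)) * v i * w i
       + dF i (x i) * u i * (v i * w (s_idx i) + v (s_idx i) * w i)) * z 0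
     + (dF i (x i) * u i * (v 0 * w (s_idx i) + v (s_idx i) * w 0)
       - u (s_idx i) * (v 0 * w i + v i * w 0)
       - u 0 * (v i * w (s_idx i) + v (s_idx i) * w i)) * z i
     + (u 0 * v i * w i - dF i (x i) * u i * (v 0 * w i + v i * w 0)) * z (s_idx i)"

lemma christoffel1_term_DERIV:
  "i \<in> I \<Longrightarrow> ((\<lambda>t. christoffel1_term i (\<lambda>a. x a + t * u a) v w z)
    has_real_derivative christoffel1_term_deriv i x u v w z) (at 0)"
  unfolding christoffel1_term_def christoffel1_term_deriv_def christoffel_s_def
  by (auto intro!: derivative_eq_intros F_line_DERIV simp: algebra_simps)

abbreviation \<Gamma> :: "pt \<Rightarrow> pt \<Rightarrow> vfield" where
  "\<Gamma> v w \<equiv> conn N g (\<lambda>_. v) (\<lambda>_. w)"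

lemma gval_\<Gamma>:
  assumes "x \<in> pts N" "u \<in> pts N" "v \<in> pts N" "w \<in> pts N"
  shows "gval N g x (\<Gamma> u v x) w = (\<Sum>i\<in>I. christoffel1_term i x u v w)"
proof -
  have "2 * gval N g x (\<Gamma> u v x) w
      = (\<Sum>i\<in>I. gF_term_deriv i x u v w + gF_term_deriv i x v u w - gF_term_deriv i x w u v)"
    using assms by (simp add: koszul_const ddir_gval_const sum.distrib sum_subtractf)
  also have "\<dots> = (\<Sum>i\<in>I. 2 * christoffel1_term i x u v w)"
    by (intro sum.cong refl)
      (simp add: gF_term_deriv_def christoffel1_term_def christoffel_s_def algebra_simps)
  finally show ?thesis by (simp flip: sum_distrib_left)
qed

lemma \<Gamma>_components [simp]:
  assumes "x \<in> pts N" "v \<in> pts N" "w \<in> pts N"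
  shows "\<Gamma> v w x 0 = 0" "i \<in> I \<Longrightarrow> \<Gamma> v w x i = 0"
    "i \<in> I \<Longrightarrow> \<Gamma> v w x (s_idx i) = eps i * christoffel_s i x v w"
proof -
  have lower: "lower N g x (\<Gamma> v w x) a = (\<Sum>i\<in>I. christoffel1_term i x v w (coord_vec a))"
    if "a < N" for a
    using assms that by (simp add: gval_\<Gamma> coord_vec_pts flip: gval_coord_vec)
  show "\<Gamma> v w x 0 = 0"
    using lower[of "v_idx 0"] by (simp add: christoffel1_term_def coord_vec_def)
  show "\<Gamma> v w x i = 0" if "i \<in> I"
    using lower[of "v_idx i"] that by (simp add: christoffel1_term_def coord_vec_def)
  show "\<Gamma> v w x (s_idx i) = eps i * christoffel_s i x v w" if "i \<in> I"
    using lower[of "s_idx i"] that eps_cancel[OF that, of "\<Gamma> v w x (s_idx i)"]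
    by (simp add: christoffel1_term_def coord_vec_def if_distrib[of "\<lambda>z. _ * z"] cong: if_cong)
qed

lemma gval_\<Gamma>_\<Gamma>:
  assumes "x \<in> pts N" "u \<in> pts N" "v \<in> pts N" "w \<in> pts N" "z \<in> pts N"
  shows "gval N g x (\<Gamma> u v x) (\<Gamma> w z x)
    = (\<Sum>i\<in>I. eps i * christoffel_s i x u v * christoffel_s i x w z)"
  using assms by (simp add: gval_expand gF_term_def mult_ac eps_cancel)

lemma ddir_gval_\<Gamma>:
  assumes "x \<in> pts N" "u \<in> pts N" "v \<in> pts N" "w \<in> pts N" "z \<in> pts N"
  shows "ddir N (\<lambda>_. u) (\<lambda>y. gval N g y (\<Gamma> v w y) z) x
      = (\<Sum>i\<in>I. christoffel1_term_deriv i x u v w z)"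
proof (rule ddir_const_field_eqI[OF _ assms(1,2)])
  show "smooth_on N (pts N) (\<lambda>y. gval N g y (\<Gamma> v w y) z)"
    using assms by (intro smooth_on_gval smooth_field_conn smooth_field_const)
  have "((\<lambda>t. \<Sum>i\<in>I. christoffel1_term i (\<lambda>a. x a + t * u a) v w z) has_real_derivative
      (\<Sum>i\<in>I. christoffel1_term_deriv i x u v w z)) (at 0)"
    by (intro DERIV_sum christoffel1_term_DERIV)
  moreover have "(\<lambda>a. x a + t * u a) \<in> pts N" for t
    using assms by (simp add: pts_def)
  ultimately show "((\<lambda>t. gval N g (\<lambda>a. x a + t * u a) (\<Gamma> v w (\<lambda>a. x a + t * u a)) z)
      has_real_derivative (\<Sum>i\<in>I. christoffel1_term_deriv i x u v w z)) (at 0)"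
    using assms by (simp add: gval_\<Gamma>)
qed

section \<open>The covariant derivatives of the curvature in closed form\<close>

definition du0_du :: "nat \<Rightarrow> pt \<Rightarrow> pt \<Rightarrow> real" where
  "du0_du i v w = v 0 * w i - v i * w 0"

definition du_ds :: "nat \<Rightarrow> pt \<Rightarrow> pt \<Rightarrow> real" where
  "du_ds i v w = v i * w (s_idx i) - v (s_idx i) * w i"

definition p_coeff :: "nat \<Rightarrow> nat \<Rightarrow> real \<Rightarrow> real" where
  "p_coeff i l u = (if l = 0 then 1 + dF i u else (deriv ^^ (l + 1)) (F i) u)"

primrec h_coeff :: "nat \<Rightarrow> nat \<Rightarrow> pt \<Rightarrow> real" where
  "h_coeff i 0 = (\<lambda>x. eps i * (F i (x i) * F i (x i)))"
| "h_coeff i (Suc l) = (\<lambda>x. pd (h_coeff i l) i x + 2 * eps i * F i (x i) * p_coeff i l (x i))"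

definition curv_term :: "nat \<Rightarrow> nat \<Rightarrow> pt \<Rightarrow> pt \<Rightarrow> pt \<Rightarrow> pt \<Rightarrow> pt \<Rightarrow> real" where
  "curv_term i l x v1 v2 v3 v4 =
     p_coeff i l (x i) * (du0_du i v1 v2 * du_ds i v3 v4 + du_ds i v1 v2 * du0_du i v3 v4)
     - h_coeff i l x * (du0_du i v1 v2 * du0_du i v3 v4)"

text \<open>The first four entries of the list are the arguments of \<open>R\<close>, the others the directions of
  differentiation.\<close>

definition curv_form :: "nat \<Rightarrow> pt \<Rightarrow> pt list \<Rightarrow> real" where
  "curv_form l x vs
      = (\<Sum>i\<in>I. curv_term i l x (vs ! 0) (vs ! 1) (vs ! 2) (vs ! 3) * (\<Prod>y\<leftarrow>drop 4 vs. y i))"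

lemma curv_form_Cons:
  "curv_form l x (v1 # v2 # v3 # v4 # ys) = (\<Sum>i\<in>I. curv_term i l x v1 v2 v3 v4 * (\<Prod>y\<leftarrow>ys. y i))"
  by (simp add: curv_form_def numeral_eq_Suc)

lemma smooth_fn_higher_deriv: "smooth_fn q \<Longrightarrow> smooth_fn ((deriv ^^ n) q)"
  by (induction n) (auto intro: smooth_fn_deriv)

lemma p_coeff_DERIV:
  assumes i: "i \<in> I"
  shows "(p_coeff i l has_real_derivative p_coeff i (Suc l) u) (at u)"
proof -
  note smooth = smooth_fn_higher_deriv[OF smooth_F[OF i]]
  show ?thesis
  proof (cases l)
    case 0
    then show ?thesis
      using smooth_fn_DERIV[OF smooth[of 1], of u]
      by (auto simp: p_coeff_def[abs_def] intro!: derivative_eq_intros)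
  next
    case (Suc m)
    then show ?thesis
      using smooth_fn_DERIV[OF smooth[of "Suc (Suc m)"], of u] by (simp add: p_coeff_def[abs_def])
  qed
qed

lemma smooth_on_p_coeff:
  assumes i: "i \<in> I"
  shows "smooth_on N (pts N) (\<lambda>x. p_coeff i l (x i))"
proof -
  have "smooth_on N (pts N) (\<lambda>x. (deriv ^^ n) (F i) (x i))" for n
    by (rule smooth_on_smooth_fn[OF smooth_fn_higher_deriv[OF smooth_F[OF i]] smooth_on_coordinate])
  from this[of 1] this[of "l + 1"] show ?thesis
    by (cases l) (simp_all add: p_coeff_def smooth_on_add smooth_on_const)
qed

lemma smooth_on_h_coeff: "i \<in> I \<Longrightarrow> smooth_on N (pts N) (h_coeff i l)"
proof (induction l)
  case 0
  then show ?case
    by (auto intro!: smooth_on_mult smooth_on_const smooth_on_F)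
next
  case (Suc l)
  then show ?case
    by (auto intro!: smooth_on_add smooth_on_mult smooth_on_const smooth_on_pd
        smooth_on_p_coeff smooth_on_F)
qed

lemma h_coeff_cong: "x i = y i \<Longrightarrow> h_coeff i l x = h_coeff i l y"
proof (induction l arbitrary: x y)
  case (Suc l)
  have "h_coeff i l (x(i := x i + t)) = h_coeff i l (y(i := y i + t))" for t
    using Suc.prems by (intro Suc.IH) simp
  then show ?case using Suc.prems by (simp add: pd_def)
qed simp

lemma ddir_p_coeff:
  assumes "i \<in> I" "x \<in> pts N" "y \<in> pts N"
  shows "ddir N (\<lambda>_. y) (\<lambda>x. p_coeff i l (x i)) x = y i * p_coeff i (Suc l) (x i)"
proof (rule ddir_const_field_eqI[OF smooth_on_p_coeff assms(2,3)])
  have "((\<lambda>t. x i + t * y i) has_real_derivative y i) (at 0)"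
    by (auto intro!: derivative_eq_intros)
  then show "((\<lambda>t. p_coeff i l (x i + t * y i))
      has_real_derivative y i * p_coeff i (Suc l) (x i)) (at 0)"
    using DERIV_chain2[OF p_coeff_DERIV[OF assms(1)]] by (fastforce simp: mult.commute)
qed (rule assms)

lemma ddir_h_coeff:
  assumes "i \<in> I"
  shows "ddir N (\<lambda>_. y) (h_coeff i l) x
    = y i * (h_coeff i (Suc l) x - 2 * eps i * F i (x i) * p_coeff i l (x i))"
proof -
  have "pd (h_coeff i l) a x = 0" if "a \<noteq> i" for a
    using h_coeff_cong[of "x(a := x a + _)" i x l] that by (simp add: pd_def)
  then have "ddir N (\<lambda>_. y) (h_coeff i l) x
      = (\<Sum>a<N. if a = i then y a * pd (h_coeff i l) a x else 0)"
    unfolding ddir_def by (intro sum.cong) auto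
  then show ?thesis using assms by simp
qed

lemma curvature_curv_form:
  assumes x: "x \<in> pts N" and uvwz: "u \<in> pts N" "v \<in> pts N" "w \<in> pts N" "z \<in> pts N"
  shows "tensor_at (nablaR N g 0) x [u, v, w, z] = curv_form 0 x [u, v, w, z]"
proof -
  have "tensor_at (nablaR N g 0) x [u, v, w, z]
      = (\<Sum>i\<in>I. christoffel1_term_deriv i x u v w z - christoffel1_term_deriv i x v u w z
        - eps i * christoffel_s i x v w * christoffel_s i x u z
        + eps i * christoffel_s i x u w * christoffel_s i x v z)"
    using assms
    by (simp only: tensor_at_curvature ddir_gval_\<Gamma> gval_\<Gamma>_\<Gamma> sum_subtractf sum.distrib)
  also have "\<dots> = (\<Sum>i\<in>I. curv_term i 0 x u v w z)"
    by (intro sum.cong refl) (simp add: christoffel1_term_deriv_def christoffel_s_def curv_term_def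
        p_coeff_def du0_du_def du_ds_def algebra_simps)
  finally show ?thesis by (simp add: curv_form_Cons)
qed

lemma ddir_curv_form:
  assumes x: "x \<in> pts N" and y: "y \<in> pts N"
  shows "ddir N (\<lambda>_. y) (\<lambda>x. curv_form l x (v1 # v2 # v3 # v4 # ys)) x
    = curv_form (Suc l) x (v1 # v2 # v3 # v4 # ys @ [y])
      + (\<Sum>i\<in>I. 2 * eps i * F i (x i) * p_coeff i l (x i) * y i * (du0_du i v1 v2 * du0_du i v3 v4)
          * (\<Prod>y\<leftarrow>ys. y i))"
proof -
  have "ddir N (\<lambda>_. y) (\<lambda>x. curv_term i l x v1 v2 v3 v4) x
      = y i * (curv_term i (Suc l) x v1 v2 v3 v4
        + 2 * eps i * F i (x i) * p_coeff i l (x i) * (du0_du i v1 v2 * du0_du i v3 v4))"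
    if i: "i \<in> I" for i
    unfolding curv_term_def using i x y
    by (simp add: ddir_diff ddir_mult ddir_const ddir_p_coeff ddir_h_coeff smooth_on_mult
        smooth_on_const smooth_on_p_coeff smooth_on_h_coeff del: h_coeff.simps)
      (simp add: algebra_simps del: h_coeff.simps)
  moreover have "smooth_on N (pts N) (\<lambda>x. curv_term i l x v1 v2 v3 v4)" if "i \<in> I" for i
    unfolding curv_term_def using that
    by (intro smooth_on_diff smooth_on_mult smooth_on_const smooth_on_p_coeff smooth_on_h_coeff)
  ultimately show ?thesis
    using x by (simp add: curv_form_Cons ddir_sum ddir_mult ddir_const smooth_on_mult
        smooth_on_const sum.distrib[symmetric] algebra_simps)
qed

text \<open>The forms \<open>du\<^sub>i\<close> are parallel and the covariant derivative of \<open>du\<^sub>i \<and> ds\<^sub>i\<close> along \<open>y\<close> is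
  \<open>eps\<^sub>i f\<^sub>i du\<^sub>i(y) du\<^sub>i \<and> du\<^sub>0\<close>; this is the source of the recursion for \<open>h_coeff\<close>.\<close>

lemma du_ds_\<Gamma>:
  assumes "i \<in> I" "x \<in> pts N" "y \<in> pts N" "v \<in> pts N" "w \<in> pts N"
  shows "du_ds i (\<Gamma> y v x) w + du_ds i v (\<Gamma> y w x) = eps i * F i (x i) * y i * du0_du i v w"
  using assms by (simp add: du_ds_def du0_du_def christoffel_s_def algebra_simps)

lemma curv_term_\<Gamma>:
  assumes i: "i \<in> I" and x: "x \<in> pts N" and y: "y \<in> pts N"
    and vs: "v1 \<in> pts N" "v2 \<in> pts N" "v3 \<in> pts N" "v4 \<in> pts N"
  shows "curv_term i l x (\<Gamma> y v1 x) v2 v3 v4 + curv_term i l x v1 (\<Gamma> y v2 x) v3 v4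
      + curv_term i l x v1 v2 (\<Gamma> y v3 x) v4 + curv_term i l x v1 v2 v3 (\<Gamma> y v4 x)
    = 2 * eps i * F i (x i) * p_coeff i l (x i) * y i * (du0_du i v1 v2 * du0_du i v3 v4)"
proof -
  have parallel: "du0_du i (\<Gamma> y v x) w = 0" "du0_du i v (\<Gamma> y w x) = 0"
    if "v \<in> pts N" "w \<in> pts N" for v w
    using that i x y by (simp_all add: du0_du_def)
  have "curv_term i l x (\<Gamma> y v1 x) v2 v3 v4 + curv_term i l x v1 (\<Gamma> y v2 x) v3 v4
      + curv_term i l x v1 v2 (\<Gamma> y v3 x) v4 + curv_term i l x v1 v2 v3 (\<Gamma> y v4 x)
    = p_coeff i l (x i) * ((du_ds i (\<Gamma> y v1 x) v2 + du_ds i v1 (\<Gamma> y v2 x)) * du0_du i v3 v4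
      + du0_du i v1 v2 * (du_ds i (\<Gamma> y v3 x) v4 + du_ds i v3 (\<Gamma> y v4 x)))"
    using vs by (simp add: curv_term_def parallel algebra_simps)
  also have "\<dots> = 2 * eps i * F i (x i) * p_coeff i l (x i) * y i
      * (du0_du i v1 v2 * du0_du i v3 v4)"
    unfolding du_ds_\<Gamma>[OF i x y vs(1,2)] du_ds_\<Gamma>[OF i x y vs(3,4)] by (simp add: algebra_simps)
  finally show ?thesis .
qed

lemma sum_slots_curv_form:
  assumes x: "x \<in> pts N" and y: "y \<in> pts N"
    and vs: "set (v1 # v2 # v3 # v4 # ys) \<subseteq> pts N" and l: "length ys = l"
  defines "vs \<equiv> v1 # v2 # v3 # v4 # ys"
  shows "(\<Sum>j<4 + l. curv_form l x (vs[j := \<Gamma> y (vs ! j) x]))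
    = (\<Sum>i\<in>I. 2 * eps i * F i (x i) * p_coeff i l (x i) * y i
        * (du0_du i v1 v2 * du0_du i v3 v4) * (\<Prod>y\<leftarrow>ys. y i))"
proof -
  have tail: "curv_form l x (v1 # v2 # v3 # v4 # ys[j := \<Gamma> y (ys ! j) x]) = 0" if j: "j < l" for j
  proof -
    have "ys ! j \<in> pts N" using vs j l by (auto simp: subset_iff)
    then have zero: "(\<Prod>y\<leftarrow>ys[j := \<Gamma> y (ys ! j) x]. y i) = 0" if "i \<in> I" for i
      using that j l x y by (simp add: prod_list_zero_iff map_update set_update_memI)
    show ?thesis by (simp add: curv_form_Cons zero)
  qed
  have "(\<Sum>j<4 + l. curv_form l x (vs[j := \<Gamma> y (vs ! j) x]))
      = curv_form l x (\<Gamma> y v1 x # v2 # v3 # v4 # ys) + curv_form l x (v1 # \<Gamma> y v2 x # v3 # v4 # ys)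
        + curv_form l x (v1 # v2 # \<Gamma> y v3 x # v4 # ys)
        + curv_form l x (v1 # v2 # v3 # \<Gamma> y v4 x # ys)
        + (\<Sum>j<l. curv_form l x (v1 # v2 # v3 # v4 # ys[j := \<Gamma> y (ys ! j) x]))"
    by (simp add: vs_def numeral_eq_Suc sum.lessThan_Suc_shift del: sum.lessThan_Suc)
  also have "\<dots> = (\<Sum>i\<in>I. (curv_term i l x (\<Gamma> y v1 x) v2 v3 v4 + curv_term i l x v1 (\<Gamma> y v2 x) v3 v4
      + curv_term i l x v1 v2 (\<Gamma> y v3 x) v4 + curv_term i l x v1 v2 v3 (\<Gamma> y v4 x)) * (\<Prod>y\<leftarrow>ys. y i))"
    by (simp add: tail) (simp add: curv_form_Cons sum.distrib distrib_right)
  finally show ?thesis using vs by (simp add: curv_term_\<Gamma> x y)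
qed

theorem nablaR_curv_form:
  assumes "x \<in> pts N" "length vs = 4 + l" "set vs \<subseteq> pts N"
  shows "tensor_at (nablaR N g l) x vs = curv_form l x vs"
  using assms
proof (induction l arbitrary: x vs)
  case 0
  then obtain u v w z where "vs = [u, v, w, z]"
    by (auto simp: length_Suc_conv numeral_eq_Suc)
  with 0 show ?case by (simp add: curvature_curv_form del: nablaR.simps)
next
  case (Suc l)
  obtain ws y where vs: "vs = ws @ [y]" and ws: "length ws = 4 + l"
    using Suc.prems(2) by (cases vs rule: rev_cases) auto
  obtain v1 v2 v3 v4 ys where ws_eq: "ws = v1 # v2 # v3 # v4 # ys" and ys: "length ys = l"
    using ws by (auto simp: length_Suc_conv numeral_eq_Suc)
  have pts: "y \<in> pts N" "set ws \<subseteq> pts N" and x: "x \<in> pts N"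
    using Suc.prems vs by auto
  have "tensor_at (nablaR N g (Suc l)) x vs = ddir N (\<lambda>_. y) (\<lambda>x. tensor_at (nablaR N g l) x ws) x
      - (\<Sum>j<4 + l. tensor_at (nablaR N g l) x (ws[j := \<Gamma> y (ws ! j) x]))"
    unfolding vs by (rule tensor_at_nablaR_Suc[OF ws pts(2,1) x])
  also have "ddir N (\<lambda>_. y) (\<lambda>x. tensor_at (nablaR N g l) x ws) x
      = ddir N (\<lambda>_. y) (\<lambda>x. curv_form l x ws) x"
    using Suc.IH[OF _ ws pts(2)] by (intro ddir_cong[OF x refl])
  also have "(\<Sum>j<4 + l. tensor_at (nablaR N g l) x (ws[j := \<Gamma> y (ws ! j) x]))
      = (\<Sum>j<4 + l. curv_form l x (ws[j := \<Gamma> y (ws ! j) x]))"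
    using ws pts by (intro sum.cong refl Suc.IH[OF x] set_update_subsetI conn_pts) auto
  finally show ?case
    using pts ddir_curv_form[OF x pts(1), of l v1 v2 v3 v4 ys]
        sum_slots_curv_form[OF x pts(1) _ ys, of v1 v2 v3 v4]
    by (simp add: vs ws_eq del: nablaR.simps)
qed

end

section \<open>Vectors singled out by the curvature\<close>

context plane_wave
begin

definition curv_null :: "pt \<Rightarrow> pt set" where
  "curv_null x = {n \<in> pts N. \<forall>a\<in>pts N. \<forall>b\<in>pts N. \<forall>c\<in>pts N. curv_form 0 x [n, a, b, c] = 0}"

definition vs_span :: "pt set" where
  "vs_span = {w \<in> pts N. w 0 = 0 \<and> (\<forall>i\<in>I. w i = 0)}"

lemma p_coeff_nonzero: "i \<in> I \<Longrightarrow> p_coeff i 0 u \<noteq> 0" "i \<in> I \<Longrightarrow> p_coeff i 1 u \<noteq> 0"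
  using dF_nonzero ddF_nonzero by (simp_all add: p_coeff_def)

lemma coord_vec_v_curv_null:
  "coord_vec (v_idx 0) \<in> curv_null x"
  "i \<in> I \<Longrightarrow> coord_vec (v_idx i) \<in> curv_null x"
  by (auto simp: curv_null_def coord_vec_pts)
    (auto simp: curv_form_Cons curv_term_def du0_du_def du_ds_def coord_vec_def)

lemma curv_form_single:
  assumes "i \<in> I" "\<And>j. j \<in> I \<Longrightarrow> j \<noteq> i \<Longrightarrow> curv_term j l x v1 v2 v3 v4 = 0"
  shows "curv_form l x (v1 # v2 # v3 # v4 # ys) = curv_term i l x v1 v2 v3 v4 * (\<Prod>y\<leftarrow>ys. y i)"
  unfolding curv_form_Cons using assms by (subst sum.remove[of I i]) auto

lemma curv_null_components:
  assumes n: "n \<in> curv_null x" and i: "i \<in> I"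
  shows "n 0 = 0" "n i = 0" "n (s_idx i) = 0"
proof -
  have null: "curv_form 0 x [n, coord_vec a, coord_vec b, coord_vec c] = 0"
    if "a < N" "b < N" "c < N" for a b c
    using n that by (simp add: curv_null_def coord_vec_pts)
  note p = p_coeff_nonzero(1)[OF i, of "x i"]
  have "curv_form 0 x [n, coord_vec i, coord_vec i, coord_vec (s_idx i)] = p_coeff i 0 (x i) * n 0"
    using i by (subst curv_form_single[OF i])
        (auto simp: curv_term_def du0_du_def du_ds_def coord_vec_def)
  then show n0: "n 0 = 0" using null[of i i "s_idx i"] i p by simp
  have "curv_form 0 x [n, coord_vec 0, coord_vec i, coord_vec (s_idx i)]
      = - p_coeff i 0 (x i) * n i"
    using i by (subst curv_form_single[OF i])
        (auto simp: curv_term_def du0_du_def du_ds_def coord_vec_def)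
  then show "n i = 0" using null[of 0 i "s_idx i"] i p by simp
  have "curv_form 0 x [n, coord_vec i, coord_vec 0, coord_vec i]
      = - p_coeff i 0 (x i) * n (s_idx i)"
    using i n0 by (subst curv_form_single[OF i])
        (auto simp: curv_term_def du0_du_def du_ds_def coord_vec_def)
  then show "n (s_idx i) = 0" using null[of i 0 i] i p by simp
qed

lemma vs_span_orthogonal_complement:
  "vs_span = {w \<in> pts N. \<forall>n\<in>curv_null x. gval N g x w n = 0}"
proof (intro equalityI subsetI)
  fix w assume w: "w \<in> vs_span"
  have "gval N g x w n = 0" if n: "n \<in> curv_null x" for n
  proof -
    have "1 \<in> I" using k_pos by (simp add: I_def)
    then have "n 0 = 0" by (rule curv_null_components(1)[OF n])
    then show ?thesis
      using w curv_null_components(2,3)[OF n] by (simp add: gval_expand gF_term_def vs_span_def)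
  qed
  with w show "w \<in> {w \<in> pts N. \<forall>n\<in>curv_null x. gval N g x w n = 0}"
    by (simp add: vs_span_def)
next
  fix w assume w: "w \<in> {w \<in> pts N. \<forall>n\<in>curv_null x. gval N g x w n = 0}"
  have "w 0 = 0"
    using w coord_vec_v_curv_null(1)[of x] gval_coord_vec[of "v_idx 0" x w] by simp
  moreover have "w i = 0" if "i \<in> I" for i
    using w coord_vec_v_curv_null(2)[OF that, of x] gval_coord_vec[of "v_idx i" x w] that by simp
  ultimately show "w \<in> vs_span" using w by (simp add: vs_span_def)
qed

lemma coord_vec_s_vs_span: "i \<in> I \<Longrightarrow> coord_vec (s_idx i) \<in> vs_span"
  by (auto simp: vs_span_def coord_vec_pts) (auto simp: coord_vec_def)

lemma gval_vs_span:
  "w \<in> vs_span \<Longrightarrow> w' \<in> vs_span \<Longrightarrow> gval N g x w w' = (\<Sum>i\<in>I. eps i * (w (s_idx i) * w' (s_idx i)))"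
  by (simp add: gval_expand gF_term_def vs_span_def mult.assoc)

lemma curv_form_vs_span:
  assumes "w \<in> vs_span"
  shows "curv_form l x (a # b # c # w # ys)
    = (\<Sum>i\<in>I. p_coeff i l (x i) * (\<Prod>y\<leftarrow>ys. y i) * (du0_du i a b * c i * w (s_idx i)))"
  unfolding curv_form_Cons
  by (rule sum.cong) (use assms in \<open>auto simp: vs_span_def curv_term_def du0_du_def du_ds_def\<close>)

lemma curv_form_vs_span_coord:
  assumes "w \<in> vs_span" "i \<in> I"
  shows "curv_form l x (coord_vec 0 # coord_vec i # coord_vec i # w # ys)
    = p_coeff i l (x i) * (\<Prod>y\<leftarrow>ys. y i) * w (s_idx i)"
proof -
  have "du0_du j (coord_vec 0) (coord_vec i) = (if j = i then 1 else 0)" if "j \<in> I" for j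
    using that assms(2) by (auto simp: du0_du_def coord_vec_def)
  then show ?thesis
    using assms(2) unfolding curv_form_vs_span[OF assms(1)]
    by (subst sum.remove[of I i]) (auto simp: coord_vec_def intro!: sum.neutral)
qed

definition agreement_dir :: "pt \<Rightarrow> pt" where
  "agreement_dir x = (\<lambda>i. if i \<in> I then p_coeff i 0 (x i) / p_coeff i 1 (x i) else 0)"

lemma agreement_dir_pts: "agreement_dir x \<in> pts N"
  by (auto simp: agreement_dir_def pts_def I_def N_def)

lemma curv_form_agreement_dir:
  assumes "w \<in> vs_span"
  shows "curv_form 1 x [a, b, c, w, agreement_dir x] = curv_form 0 x [a, b, c, w]"
  using p_coeff_nonzero(2)
  by (auto simp: curv_form_vs_span[OF assms] agreement_dir_def intro!: sum.cong)

lemma agreement_dir_unique: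
  assumes i: "i \<in> I"
    and agree: "\<And>a b c w. a \<in> pts N \<Longrightarrow> b \<in> pts N \<Longrightarrow> c \<in> pts N \<Longrightarrow> w \<in> vs_span \<Longrightarrow>
      curv_form 1 x [a, b, c, w, y] = curv_form 0 x [a, b, c, w]"
  shows "y i = agreement_dir x i"
proof -
  have "p_coeff i 1 (x i) * y i = p_coeff i 0 (x i)"
    using agree[of "coord_vec 0" "coord_vec i" "coord_vec i" "coord_vec (s_idx i)"] i
      curv_form_vs_span_coord[OF coord_vec_s_vs_span[OF i] i, of _ x]
    by (simp add: coord_vec_s_vs_span coord_vec_pts) (simp add: coord_vec_def)
  then show ?thesis
    using p_coeff_nonzero(2)[OF i, of "x i"] i by (simp add: agreement_dir_def field_simps)
qed

definition beta_term :: "nat \<Rightarrow> nat \<Rightarrow> pt \<Rightarrow> real" where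
  "beta_term i l x = p_coeff i l (x i) * p_coeff i 0 (x i) ^ (l - 1) / p_coeff i 1 (x i) ^ l"

lemma beta_eq_sum: "l \<ge> 1 \<Longrightarrow> beta l F k x = (\<Sum>i\<in>I. beta_term i l x)"
  by (simp add: beta_def beta_term_def p_coeff_def I_def numeral_2_eq_2)

lemma p_coeff_agreement_dir_power:
  assumes "i \<in> I" "l \<ge> 1"
  shows "p_coeff i l (x i) * agreement_dir x i ^ l = beta_term i l x * p_coeff i 0 (x i)"
proof -
  obtain m where "l = Suc m" using assms(2) by (cases l) auto
  then show ?thesis using assms(1) by (simp add: agreement_dir_def beta_term_def power_divide)
qed

lemma curv_form_s_eigenvector:
  assumes i: "i \<in> I" and l: "l \<ge> 1"
  shows "curv_form l x (a # b # c # coord_vec (s_idx i) # replicate l (agreement_dir x))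
    = beta_term i l x * curv_form 0 x [a, b, c, coord_vec (s_idx i)]"
  unfolding curv_form_vs_span[OF coord_vec_s_vs_span[OF i]] sum_distrib_left
proof (rule sum.cong)
  fix j assume "j \<in> I"
  then show "p_coeff j l (x j) * (\<Prod>y\<leftarrow>replicate l (agreement_dir x). y j)
      * (du0_du j a b * c j * coord_vec (s_idx i) (s_idx j))
      = beta_term i l x * (p_coeff j 0 (x j) * (\<Prod>y\<leftarrow>[]. y j)
        * (du0_du j a b * c j * coord_vec (s_idx i) (s_idx j)))"
    using p_coeff_agreement_dir_power[OF i l, of x] by (cases "j = i") (simp_all add: coord_vec_def)
qed simp

definition s_block :: "(pt \<Rightarrow> pt) \<Rightarrow> nat \<Rightarrow> nat \<Rightarrow> real" where
  "s_block T j i = T (coord_vec (s_idx i)) (s_idx j)"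

end

section \<open>Isomorphisms of models preserve the invariants\<close>

lemma trace_eq_of_intertwining:
  fixes b b' :: "'i \<Rightarrow> 'a::comm_semiring_1"
  assumes intertwine: "\<And>i j. i \<in> I \<Longrightarrow> j \<in> I \<Longrightarrow> b' j * M j i = b i * M j i"
    and inverse: "\<And>j. j \<in> I \<Longrightarrow> (\<Sum>i\<in>I. M j i * M' i j) = 1" "\<And>i. i \<in> I \<Longrightarrow> (\<Sum>j\<in>I. M' i j * M j i) = 1"
  shows "sum b' I = sum b I"
proof -
  have "sum b' I = (\<Sum>j\<in>I. b' j * (\<Sum>i\<in>I. M j i * M' i j))"
    by (simp add: inverse)
  also have "\<dots> = (\<Sum>j\<in>I. \<Sum>i\<in>I. b i * (M' i j * M j i))"
    unfolding sum_distrib_left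
    by (intro sum.cong refl) (simp add: intertwine mult_ac flip: mult.assoc[of "b' _"])
  also have "\<dots> = (\<Sum>i\<in>I. b i * (\<Sum>j\<in>I. M' i j * M j i))"
    unfolding sum_distrib_left by (rule sum.swap)
  also have "\<dots> = sum b I"
    by (simp add: inverse)
  finally show ?thesis .
qed

locale wave_model_iso = P: plane_wave k eps F + Q: plane_wave k eps F'
  for k eps F F' +
  fixes p q :: pt and \<Phi> \<Psi> :: "pt \<Rightarrow> pt" and l :: nat
  assumes maps: "\<Phi> v \<in> pts P.N" "\<Psi> v \<in> pts P.N"
    and inverse: "v \<in> pts P.N \<Longrightarrow> \<Psi> (\<Phi> v) = v" "v \<in> pts P.N \<Longrightarrow> \<Phi> (\<Psi> v) = v"
    and isometric: "v \<in> pts P.N \<Longrightarrow> w \<in> pts P.N \<Longrightarrow> gval P.N Q.g q (\<Phi> v) (\<Phi> w) = gval P.N P.g p v w"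
    and curv: "i \<le> l \<Longrightarrow> length vs = 4 + i \<Longrightarrow> set vs \<subseteq> pts P.N \<Longrightarrow>
      Q.curv_form i q (map \<Phi> vs) = P.curv_form i p vs"
begin

abbreviation "N \<equiv> P.N"
abbreviation "I \<equiv> P.I"
abbreviation "s_idx \<equiv> P.s_idx"
abbreviation "vs_span \<equiv> P.vs_span"
abbreviation "s_block \<equiv> P.s_block"

lemma swap: "wave_model_iso k eps F' F q p \<Psi> \<Phi> l"
proof unfold_locales
  show "gval N P.g p (\<Psi> v) (\<Psi> w) = gval N Q.g q v w" if "v \<in> pts N" "w \<in> pts N" for v w
    using isometric[OF maps(2) maps(2), of v w] that by (simp add: inverse)
  show "P.curv_form i p (map \<Psi> vs) = Q.curv_form i q vs"
    if "i \<le> l" "length vs = 4 + i" "set vs \<subseteq> pts N" for i vs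
  proof -
    have "map \<Phi> (map \<Psi> vs) = vs"
      using that(3) inverse(2) by (auto intro!: map_idI)
    then show ?thesis
      using curv[OF that(1), of "map \<Psi> vs"] that(2) by (simp add: image_subset_iff maps)
  qed
qed (use maps inverse in auto)

lemma \<Phi>_vs_span:
  assumes "w \<in> vs_span"
  shows "\<Phi> w \<in> vs_span"
proof -
  interpret swap: wave_model_iso k eps F' F q p \<Psi> \<Phi> l by (rule swap)
  have "\<Psi> n \<in> P.curv_null p" if n: "n \<in> Q.curv_null q" for n
    unfolding P.curv_null_def
  proof (intro CollectI conjI ballI)
    fix a b c assume "a \<in> pts N" "b \<in> pts N" "c \<in> pts N"
    then show "P.curv_form 0 p [\<Psi> n, a, b, c] = 0"
      using curv[of 0 "[\<Psi> n, a, b, c]"] n maps by (simp add: Q.curv_null_def inverse)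
  qed (rule maps)
  then have "gval N Q.g q (\<Phi> w) n = 0" if "n \<in> Q.curv_null q" for n
    using swap.isometric[of "\<Phi> w" n] that assms
    unfolding P.vs_span_orthogonal_complement[of p] by (auto simp: Q.curv_null_def inverse maps)
  then show ?thesis
    unfolding Q.vs_span_orthogonal_complement[of q] using maps by blast
qed

lemma \<Phi>_agreement_dir:
  assumes l: "l \<ge> 1" and j: "j \<in> I"
  shows "\<Phi> (P.agreement_dir p) j = Q.agreement_dir q j"
proof (rule Q.agreement_dir_unique[OF j])
  interpret swap: wave_model_iso k eps F' F q p \<Psi> \<Phi> l by (rule swap)
  fix a b c w assume vectors: "a \<in> pts N" "b \<in> pts N" "c \<in> pts N" "w \<in> vs_span"
  then have w: "w \<in> pts N" by (simp add: P.vs_span_def)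
  have "Q.curv_form 1 q [a, b, c, w, \<Phi> (P.agreement_dir p)]
      = P.curv_form 1 p [\<Psi> a, \<Psi> b, \<Psi> c, \<Psi> w, P.agreement_dir p]"
    using curv[OF l, of "[\<Psi> a, \<Psi> b, \<Psi> c, \<Psi> w, P.agreement_dir p]"] vectors w
    by (simp add: inverse maps P.agreement_dir_pts)
  also have "\<dots> = P.curv_form 0 p [\<Psi> a, \<Psi> b, \<Psi> c, \<Psi> w]"
    by (rule P.curv_form_agreement_dir[OF swap.\<Phi>_vs_span[OF vectors(4)]])
  also have "\<dots> = Q.curv_form 0 q [a, b, c, w]"
    using swap.curv[of 0 "[a, b, c, w]"] vectors w by simp
  finally show "Q.curv_form 1 q [a, b, c, w, \<Phi> (P.agreement_dir p)]
      = Q.curv_form 0 q [a, b, c, w]" .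
qed

lemma beta_term_intertwine:
  assumes l: "l \<ge> 1" and i: "i \<in> I" and j: "j \<in> I"
  shows "Q.beta_term j l q * s_block \<Phi> j i = P.beta_term i l p * s_block \<Phi> j i"
proof -
  let ?w = "coord_vec (s_idx i)" and ?a = "\<Psi> (coord_vec 0)" and ?b = "\<Psi> (coord_vec j)"
  have w: "\<Phi> ?w \<in> vs_span"
    by (rule \<Phi>_vs_span[OF P.coord_vec_s_vs_span[OF i]])
  note pts = coord_vec_pts[of 0 N] coord_vec_pts[of j N] coord_vec_pts[of "s_idx i" N]
  have "Q.p_coeff j 0 (q j) * (Q.beta_term j l q * s_block \<Phi> j i)
      = Q.curv_form l q (coord_vec 0 # coord_vec j # coord_vec j # \<Phi> ?w
          # replicate l (\<Phi> (P.agreement_dir p)))"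
    using Q.p_coeff_agreement_dir_power[OF j l, of q]
    by (simp add: Q.curv_form_vs_span_coord[OF w j] \<Phi>_agreement_dir[OF l j] P.s_block_def)
  also have "\<dots> = P.curv_form l p (?a # ?b # ?b # ?w # replicate l (P.agreement_dir p))"
    using curv[of l "?a # ?b # ?b # ?w # replicate l (P.agreement_dir p)"] pts i j
    by (simp add: inverse maps P.agreement_dir_pts set_replicate_conv_if)
  also have "\<dots> = P.beta_term i l p * P.curv_form 0 p [?a, ?b, ?b, ?w]"
    by (rule P.curv_form_s_eigenvector[OF i l])
  also have "P.curv_form 0 p [?a, ?b, ?b, ?w]
      = Q.curv_form 0 q [coord_vec 0, coord_vec j, coord_vec j, \<Phi> ?w]"
    using curv[of 0 "[?a, ?b, ?b, ?w]"] pts i j by (simp add: inverse maps)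
  also have "\<dots> = Q.p_coeff j 0 (q j) * s_block \<Phi> j i"
    using Q.curv_form_vs_span_coord[OF w j, of 0 q "[]"] by (simp add: P.s_block_def)
  finally show ?thesis using Q.p_coeff_nonzero(1)[OF j, of "q j"] by simp
qed

lemma s_block_adjoint:
  assumes i: "i \<in> I" and j: "j \<in> I"
  shows "eps j * s_block \<Phi> j i = eps i * s_block \<Psi> i j"
proof -
  have pts: "coord_vec (s_idx i) \<in> pts N" "coord_vec (s_idx j) \<in> pts N"
    using i j by (simp_all add: coord_vec_pts)
  have "eps j * s_block \<Phi> j i = gval N Q.g q (\<Phi> (coord_vec (s_idx i))) (coord_vec (s_idx j))"
    using j by (simp add: Q.gval_coord_vec P.s_block_def)
  also have "\<dots> = gval N P.g p (coord_vec (s_idx i)) (\<Psi> (coord_vec (s_idx j)))"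
    using isometric[OF pts(1) maps(2), of "coord_vec (s_idx j)"] pts by (simp add: inverse)
  also have "\<dots> = eps i * s_block \<Psi> i j"
    using i by (simp add: gval_coord_vec_left P.s_block_def)
  finally show ?thesis .
qed

lemma s_block_inverse:
  assumes i: "i \<in> I"
  shows "(\<Sum>j\<in>I. s_block \<Psi> i j * s_block \<Phi> j i) = 1"
proof -
  let ?w = "coord_vec (s_idx i)"
  have w: "?w \<in> vs_span" "?w \<in> pts N"
    using i by (simp_all add: P.coord_vec_s_vs_span coord_vec_pts)
  have "eps i * (\<Sum>j\<in>I. s_block \<Psi> i j * s_block \<Phi> j i)
      = (\<Sum>j\<in>I. eps j * (s_block \<Phi> j i * s_block \<Phi> j i))"
    unfolding sum_distrib_left
    by (intro sum.cong refl) (simp flip: mult.assoc s_block_adjoint[OF i])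
  also have "\<dots> = gval N Q.g q (\<Phi> ?w) (\<Phi> ?w)"
    using Q.gval_vs_span \<Phi>_vs_span[OF w(1)] by (simp add: P.s_block_def)
  also have "\<dots> = eps i"
    using isometric[OF w(2,2)] i by (simp add: P.gval_coord_vec) (simp add: coord_vec_def)
  finally have "eps i * (eps i * (\<Sum>j\<in>I. s_block \<Psi> i j * s_block \<Phi> j i)) = eps i * eps i" by simp
  then show ?thesis by (simp only: P.eps_cancel[OF i] P.eps_square[OF i])
qed

theorem beta_eq:
  assumes "l \<ge> 1"
  shows "beta l F k p = beta l F' k q"
proof -
  interpret swap: wave_model_iso k eps F' F q p \<Psi> \<Phi> l by (rule swap)
  have "(\<Sum>j\<in>I. Q.beta_term j l q) = (\<Sum>i\<in>I. P.beta_term i l p)"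
    using beta_term_intertwine[OF assms] swap.s_block_inverse s_block_inverse
    by (rule trace_eq_of_intertwining)
  then show ?thesis using assms by (simp add: P.beta_eq_sum Q.beta_eq_sum)
qed

end

lemma model_iso_le: "model_iso N g P g' Q A l \<Longrightarrow> i \<le> l \<Longrightarrow> model_iso N g P g' Q A i"
  by (auto simp: model_iso_def)

theorem model_iso_beta_eq:
  assumes "plane_wave k eps F" "plane_wave k eps F'"
    and p: "p \<in> pts (3 * k + 2)" and q: "q \<in> pts (3 * k + 2)"
    and iso: "model_iso (3 * k + 2) (gF k eps F) p (gF k eps F') q A l" and l: "l \<ge> 1"
  shows "beta l F k p = beta l F' k q"
proof -
  interpret P: plane_wave k eps F by fact
  interpret Q: plane_wave k eps F' by fact
  let ?\<Phi> = "lin_map P.N A" and ?\<Psi> = "lin_map P.N (array_inverse P.N A)"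
  have pq: "p \<in> pts P.N" "q \<in> pts P.N"
    using p q by (simp_all add: P.N_def)
  have isometric: "gval P.N Q.g q (?\<Phi> v) (?\<Phi> w) = gval P.N P.g p v w"
    if "v \<in> pts P.N" "w \<in> pts P.N" for v w
    using iso that by (simp add: model_iso_def P.N_def)
  have "v = (\<lambda>_. 0)" if "v \<in> pts P.N" "?\<Phi> v = (\<lambda>_. 0)" for v
    using pq(1) that(1)
  proof (rule P.nondegenerate)
    show "gval P.N P.g p v w = 0" if "w \<in> pts P.N" for w
      using isometric[OF \<open>v \<in> pts P.N\<close> that] \<open>?\<Phi> v = (\<lambda>_. 0)\<close> by (simp add: gval_def)
  qed
  then have det: "Determinant.det (array_mat P.N A) \<noteq> 0"
    by (rule det_array_mat_nonzero)
  have "Q.curv_form i q (map ?\<Phi> vs) = P.curv_form i p vs"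
    if "i \<le> l" "length vs = 4 + i" "set vs \<subseteq> pts P.N" for i vs
  proof -
    have "tensor_at (nablaR P.N Q.g i) q (map ?\<Phi> vs) = tensor_at (nablaR P.N P.g i) p vs"
      using iso that by (simp add: model_iso_def P.N_def)
    moreover have "set (map ?\<Phi> vs) \<subseteq> pts P.N"
      using lin_map_pts by auto
    ultimately show ?thesis
      using that pq by (simp add: P.nablaR_curv_form Q.nablaR_curv_form)
  qed
  then interpret wave_model_iso k eps F F' p q ?\<Phi> ?\<Psi> l
    using isometric by unfold_locales (simp_all add: lin_map_pts lin_map_array_inverse[OF det])
  show ?thesis using l by (rule beta_eq)
qed

corollary curv_homog_beta_eq:
  assumes "plane_wave k eps F" "curv_homog (3 * k + 2) (gF k eps F) l"
    and "p \<in> pts (3 * k + 2)" "q \<in> pts (3 * k + 2)" "1 \<le> i" "i \<le> l"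
  shows "beta i F k p = beta i F k q"
proof -
  obtain A where "model_iso (3 * k + 2) (gF k eps F) p (gF k eps F) q A l"
    using assms(2-4) unfolding curv_homog_def by blast
  then show ?thesis
    using model_iso_beta_eq[OF assms(1,1,3,4) model_iso_le] assms(5,6) by blast
qed

theorem theorem1p8:
  fixes k :: nat and eps :: "nat \<Rightarrow> real" and F :: "nat \<Rightarrow> real \<Rightarrow> real"
  assumes "k \<ge> 1"
    and "\<forall>i\<in>{1..k}. eps i = 1 \<or> eps i = -1"
    and "admissible k F"
  shows "(\<forall>l\<ge>1. \<forall>F' P Q A. admissible k F' \<and> P \<in> pts (3*k+2) \<and> Q \<in> pts (3*k+2) \<and>
            model_iso (3*k+2) (gF k eps F) P (gF k eps F') Q A l
            \<longrightarrow> beta l F k P = beta l F' k Q)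
       \<and> (\<forall>l\<ge>1. curv_homog (3*k+2) (gF k eps F) l \<longrightarrow>
            (\<forall>p\<in>{1..l}. \<forall>P\<in>pts (3*k+2). \<forall>Q\<in>pts (3*k+2). beta p F k P = beta p F k Q))
       \<and> (loc_homog (3*k+2) (gF k eps F) \<longrightarrow>
            (\<forall>l\<ge>1. \<forall>P\<in>pts (3*k+2). \<forall>Q\<in>pts (3*k+2). beta l F k P = beta l F k Q))"
proof -
  have wave: "plane_wave k eps G" if "admissible k G" for G
    using assms(1,2) that by unfold_locales auto
  have curv_homog: "curv_homog (3*k+2) (gF k eps F) l" if "loc_homog (3*k+2) (gF k eps F)" for l
    using loc_homog_imp_curv_homog[OF plane_wave.smooth_metric_gF[OF wave[OF assms(3)]] that] .
  show ?thesis
  proof (intro conjI allI ballI impI)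
    show "beta l F k P = beta l F' k Q"
      if "1 \<le> l" "admissible k F' \<and> P \<in> pts (3*k+2) \<and> Q \<in> pts (3*k+2) \<and>
        model_iso (3*k+2) (gF k eps F) P (gF k eps F') Q A l" for l F' P Q A
      using that model_iso_beta_eq[OF wave[OF assms(3)] wave] by blast
    show "beta p F k P = beta p F k Q" if "curv_homog (3*k+2) (gF k eps F) l" "p \<in> {1..l}"
        "P \<in> pts (3*k+2)" "Q \<in> pts (3*k+2)" for l p P Q
      using curv_homog_beta_eq[OF wave[OF assms(3)] that(1,3,4)] that(2) by simp
    show "beta l F k P = beta l F k Q" if "loc_homog (3*k+2) (gF k eps F)" "1 \<le> l"
        "P \<in> pts (3*k+2)" "Q \<in> pts (3*k+2)" for l P Q
      using curv_homog_beta_eq[OF wave[OF assms(3)] curv_homog[OF that(1)] that(3,4,2) order_refl] .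
  qed
qed

end
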